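(* For $\tau>0$ put $q=e^{-2\pi\tau}$ and define $$\Phi(\tau)=R(q)^{5/6}\sum_{n=0}^{\infty}\frac{\left(\tfrac16\right)_n^2}{\left(\tfrac76\right)_n\, n!}\left(\frac{11+5\sqrt5}{2}\right)^{n}{}_2F_1\!\left[\begin{matrix}1/6,\,-n\\ 5/6-n\end{matrix};\frac{11-5\sqrt5}{11+5\sqrt5}\right]R(q)^{5n}.$$ Then $\Phi$ is an antiderivative of $-\frac{\pi}{3}\eta(i\tau)^4$ on $(0,\infty)$, i.e. $\frac{\pi}{3}\int \eta(i\tau)^4\,d\tau=-\Phi(\tau)+C$ for a constant $C$.
   Context: $\eta(\tau)=e^{\pi i\tau/12}\prod_{n\ge1}(1-e^{2\pi i n\tau})$ is the Dedekind eta function, so for $\tau>0$, $\eta(i\tau)=e^{-\pi\tau/12}\prod_{n\ge1}(1-e^{-2\pi n\tau})$. For $0<q<1$, $R(q)$ is the Rogers–Ramanujan continued fraction $R(q)=\dfrac{q^{1/5}}{1+\dfrac{q}{1+\dfrac{q^2}{1+\dfrac{q^3}{1+\cdots}}}}$ (with the positive real fifth root). $(a)_n=a(a+1)\cdots(a+n-1)$ is the Pochhammer symbol and ${}_2F_1\!\left[\begin{matrix}a,b\\c\end{matrix};x\right]=\sum_{k\ge0}\frac{(a)_k(b)_k}{(c)_k}\frac{x^k}{k!}$ is the Gauss hypergeometric function (terminating here since $b=-n$). *)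

theory Defs
  imports "HOL-Analysis.Analysis"
begin

text \<open>The Dedekind eta function, meaningful for \<open>Im \<tau> > 0\<close>.\<close>

definition dedekind_eta :: "complex \<Rightarrow> complex" where
  "dedekind_eta \<tau> =
     exp (of_real pi * \<i> * \<tau> / 12) * (\<Prod>n. 1 - exp (2 * of_real pi * \<i> * of_nat (Suc n) * \<tau>))"

text \<open>\<open>rr_denom q k m\<close> is the finite continued fraction
  \<open>1 + q^(k+1) / (1 + q^(k+2) / (1 + \<dots> + q^(k+m) / 1))\<close>, so that the truncations of the
  Rogers--Ramanujan continued fraction are \<open>q^(1/5) / rr_denom q 0 m\<close>.\<close>

primrec rr_denom :: "real \<Rightarrow> nat \<Rightarrow> nat \<Rightarrow> real" where
  "rr_denom q k 0 = 1"
| "rr_denom q k (Suc m) = 1 + q ^ Suc k / rr_denom q (Suc k) m"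

definition rogers_ramanujan_cf :: "real \<Rightarrow> real" where
  "rogers_ramanujan_cf q = lim (\<lambda>m. root 5 q / rr_denom q 0 m)"

definition hyp2F1 :: "real \<Rightarrow> real \<Rightarrow> real \<Rightarrow> real \<Rightarrow> real" where
  "hyp2F1 a b c x =
     (\<Sum>k. pochhammer a k * pochhammer b k / pochhammer c k * (x ^ k / fact k))"

definition Phi_term :: "real \<Rightarrow> nat \<Rightarrow> real" where
  "Phi_term \<tau> n =
     (pochhammer (1/6) n)\<^sup>2 / (pochhammer (7/6) n * fact n) * ((11 + 5 * sqrt 5) / 2) ^ n
     * hyp2F1 (1/6) (- real n) (5/6 - real n) ((11 - 5 * sqrt 5) / (11 + 5 * sqrt 5))
     * rogers_ramanujan_cf (exp (- 2 * pi * \<tau>)) ^ (5 * n)"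

definition Phi :: "real \<Rightarrow> real" where
  "Phi \<tau> = rogers_ramanujan_cf (exp (- 2 * pi * \<tau>)) powr (5/6) * (\<Sum>n. Phi_term \<tau> n)"

end

theory Submission
  imports Defs "HOL-Complex_Analysis.Complex_Analysis"
begin

text \<open>Put \<open>z = R(q)\<^sup>5\<close>. The \<open>n\<close>-th term of the series is \<open>c\<^sub>n z\<^sup>n / (1 + 6 n)\<close>, where the \<open>c\<^sub>n\<close> are
  the Taylor coefficients of \<open>(1 - 11 z - z\<^sup>2) powr (-1/6)\<close>, so \<open>6 d\<Phi>/dz = z powr (-5/6) (1 - 11 z - z\<^sup>2) powr (-1/6)\<close>
  and the claim follows from two identities of Ramanujan, with \<open>f(q) = (1 - q) (1 - q\<^sup>2) (1 - q\<^sup>3) \<cdots>\<close>: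
  \<open>1/z - 11 - z = f(q)\<^sup>6 / (q f(q\<^sup>5)\<^sup>6)\<close> and \<open>q z'(q) / z(q) = E(q) = f(q)\<^sup>5 / f(q\<^sup>5)\<close>.
  Dissecting the triple product at a primitive fifth root of unity \<open>w\<close> by residues mod 5 gives
  linear forms in \<open>\<rho>(x) = R(x\<^sup>5)\<close>; multiplying over the five nomes \<open>w\<^sup>j x\<close> gives the first identity,
  and also expresses a Moebius transform of \<open>z(q)\<close> as the fifth power of one of \<open>\<rho>(q)\<close>. The logarithmic
  derivative of the latter says that \<open>E(q) f(q\<^sup>5) / f(q)\<^sup>5\<close> is invariant under \<open>q \<mapsto> q\<^sup>5\<close>, hence equals
  its value 1 at 0. The product formula for \<open>R\<close> is obtained from theta series satisfying the
  recurrence of the continued fraction.\<close>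

section \<open>Infinite q-products\<close>

text \<open>Two difficulties shape the proof. \<open>R\<close> carries the fifth root of
  \<open>q\<close>, so it is not holomorphic at 0; the analysis is therefore done with
  \<open>rr_quot\<close>, which is \<open>R\<close> without that root, and with
  \<open>R(x^5)\<close> as a function of \<open>x\<close>. And the formula for
  \<open>q z'/z\<close>, usually obtained from Lambert series, has to come from products alone. What
  makes this possible are the Gaussian periods \<open>s = w^2 + w^3\<close> and
  \<open>t = w + w^4\<close>: they give \<open>1 - y - y^2 = (1 + s y) (1 + t y)\<close>, while
  \<open>s^5\<close> and \<open>t^5\<close> do the same for \<open>1 - 11 y - y^2\<close>. The map
  \<open>(1 + s^5 z) / (1 + t^5 z)\<close> moves the zeros of the second quadratic to 0 and
  infinity, so its logarithmic derivative is \<open>(s^5 - t^5) z' / (1 - 11 z - z^2)\<close>;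
  likewise for rho with \<open>s\<close> and \<open>t\<close>. Since
  \<open>s^5 - t^5 = 5 (s - t)\<close>, the 5 coming from the fifth power cancels and no constant is
  left. As \<open>q z'/z\<close> is \<open>E(q)\<close> and \<open>q rho'/rho\<close> is
  \<open>E(q^5)\<close>, the result compares one function at \<open>q\<close> and at
  \<open>q^5\<close>.\<close>

definition qpoch :: "complex \<Rightarrow> complex \<Rightarrow> complex" where
  "qpoch a q = (\<Prod>n. 1 - a * q ^ n)"

lemma convergent_prod_qpoch:
  fixes a q :: complex
  assumes "norm q < 1"
  shows "convergent_prod (\<lambda>n. 1 - a * q ^ n)"
proof -
  have "summable (\<lambda>n. norm (1 - a * q ^ n - 1))"
    using summable_mult[OF summable_geometric[of "norm q"], of "norm a"] assms
    by (simp add: norm_mult norm_power)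
  thus ?thesis
    by (intro abs_convergent_prod_imp_convergent_prod summable_imp_abs_convergent_prod)
qed

lemma qpoch_tendsto:
  assumes "norm q < 1"
  shows "(\<lambda>N. \<Prod>n<N. 1 - a * q ^ n) \<longlonglongrightarrow> qpoch a q"
  using convergent_prod_LIMSEQ[OF convergent_prod_qpoch[OF assms]]
  by (simp add: qpoch_def LIMSEQ_lessThan_iff_atMost)

lemma qpoch_nonzero:
  assumes "norm q < 1" "norm a < 1"
  shows "qpoch a q \<noteq> 0"
  unfolding qpoch_def
proof (rule prodinf_nonzero[OF convergent_prod_qpoch[OF assms(1)]])
  fix n
  have "norm (a * q ^ n) \<le> norm a * 1"
    unfolding norm_mult norm_power using assms by (intro mult_left_mono power_le_one) auto
  with assms show "1 - a * q ^ n \<noteq> 0" by auto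
qed

lemma qpoch_Suc:
  assumes "norm q < 1"
  shows "qpoch a q = (1 - a) * qpoch (a * q) q"
proof (rule LIMSEQ_unique)
  show "(\<lambda>N. \<Prod>n<Suc N. 1 - a * q ^ n) \<longlonglongrightarrow> qpoch a q"
    using qpoch_tendsto[OF assms] by (rule LIMSEQ_Suc)
  have "(\<lambda>N. (1 - a) * (\<Prod>n<N. 1 - (a * q) * q ^ n)) \<longlonglongrightarrow> (1 - a) * qpoch (a * q) q"
    by (intro tendsto_intros qpoch_tendsto assms)
  thus "(\<lambda>N. \<Prod>n<Suc N. 1 - a * q ^ n) \<longlonglongrightarrow> (1 - a) * qpoch (a * q) q"
    by (simp add: prod.lessThan_Suc_shift mult_ac del: prod.lessThan_Suc)
qed

lemma qpoch_1 [simp]: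
  assumes "norm q < 1"
  shows "qpoch 1 q = 0"
  using qpoch_Suc[OF assms, of 1] by simp

text \<open>The factors are grouped by their index modulo 5; since the partial products converge, it
  suffices to look at those of length \<open>N * 5\<close>.\<close>

lemma qpoch_split5:
  assumes "norm q < 1"
  shows "qpoch a q = (\<Prod>i<5. qpoch (a * q ^ i) (q ^ 5))"
proof (rule LIMSEQ_unique)
  have q5: "norm (q ^ 5) < 1"
    using assms by (simp add: norm_power power_less_one_iff)
  show "(\<lambda>N. \<Prod>n<N * 5. 1 - a * q ^ n) \<longlonglongrightarrow> qpoch a q"
    by (rule LIMSEQ_subseq_LIMSEQ[OF qpoch_tendsto[OF assms, of a], of "\<lambda>N. N * 5", unfolded o_def])
       (simp add: strict_mono_def)
  have "(\<Prod>n<N * 5. 1 - a * q ^ n) = (\<Prod>i<5. \<Prod>n<N. 1 - a * q ^ i * (q ^ 5) ^ n)" for N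
  proof -
    have "(\<Prod>n<N * 5. 1 - a * q ^ n) = (\<Prod>m<N. \<Prod>n=m*5..<m*5+5. 1 - a * q ^ n)"
      by (simp add: prod.nat_group)
    also have "\<dots> = (\<Prod>m<N. \<Prod>i<5. 1 - a * q ^ i * (q ^ 5) ^ m)"
    proof (rule prod.cong[OF refl])
      fix m
      have "(\<Prod>n=m*5..<m*5+5. 1 - a * q ^ n) = (\<Prod>i=0..<5. 1 - a * q ^ (i + m * 5))"
        using prod.shift_bounds_nat_ivl[of "\<lambda>n. 1 - a * q ^ n" 0 "m * 5" 5] by (simp add: add.commute)
      also have "\<dots> = (\<Prod>i<5. 1 - a * q ^ i * (q ^ 5) ^ m)"
        by (simp add: power_add mult_ac lessThan_atLeast0 flip: power_mult)
      finally show "(\<Prod>n=m*5..<m*5+5. 1 - a * q ^ n) = (\<Prod>i<5. 1 - a * q ^ i * (q ^ 5) ^ m)" .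
    qed
    also have "\<dots> = (\<Prod>i<5. \<Prod>n<N. 1 - a * q ^ i * (q ^ 5) ^ n)"
      by (rule prod.swap)
    finally show ?thesis .
  qed
  thus "(\<lambda>N. \<Prod>n<N * 5. 1 - a * q ^ n) \<longlonglongrightarrow> (\<Prod>i<5. qpoch (a * q ^ i) (q ^ 5))"
    using q5 by (auto intro!: tendsto_prod qpoch_tendsto)
qed

section \<open>Fifth roots of unity and q-products\<close>

lemma lessThan_5: "{..<5::nat} = {0, 1, 2, 3, 4}"
  by auto

text \<open>As 5 is prime, this says that \<open>w\<close> is a primitive fifth root of
  unity.\<close>

definition root5 :: "complex \<Rightarrow> bool" where
  "root5 w \<longleftrightarrow> w ^ 5 = 1 \<and> w \<noteq> 1"

lemma root5_sum:
  assumes "root5 w"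
  shows "1 + w + w ^ 2 + w ^ 3 + w ^ 4 = 0"
proof -
  have "(1 - w) * (1 + w + w ^ 2 + w ^ 3 + w ^ 4) = 0"
    using assms by (simp add: root5_def algebra_simps eval_nat_numeral)
  thus ?thesis using assms by (auto simp: root5_def)
qed

text \<open>The factors for \<open>w\<close>, \<open>w^4\<close> and for \<open>w^2\<close>,
  \<open>w^3\<close> combine to quadratics whose middle coefficients are the periods
  \<open>u\<close> and \<open>v\<close>; after that only \<open>v^2 + v - 1 = 0\<close> is
  needed.\<close>

lemma root5_prod:
  assumes "root5 w"
  shows "(\<Prod>j<5. X - w ^ j * Y) = X ^ 5 - Y ^ 5"
proof -
  define u v where "u = w + w ^ 4" and "v = w ^ 2 + w ^ 3"
  have w5: "w * w ^ 4 = 1" "w ^ 2 * w ^ 3 = 1" "w ^ 6 = w" "w ^ 7 = w ^ 2"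
  proof -
    have "w * w ^ 4 = w ^ 5" "w ^ 2 * w ^ 3 = w ^ 5" "w ^ 6 = w ^ 5 * w" "w ^ 7 = w ^ 5 * w ^ 2"
      by (simp_all add: eval_nat_numeral)
    thus "w * w ^ 4 = 1" "w ^ 2 * w ^ 3 = 1" "w ^ 6 = w" "w ^ 7 = w ^ 2"
      using assms by (simp_all only: root5_def mult_1)
  qed
  have u: "u = - 1 - v" using root5_sum[OF assms] unfolding u_def v_def by algebra
  have "u * v = w ^ 3 + w ^ 4 + w ^ 6 + w ^ 7"
    unfolding u_def v_def by (simp add: algebra_simps flip: power_add power_Suc power_Suc2)
  also have "\<dots> = - 1" using root5_sum[OF assms] w5 by algebra
  finally have uv: "v ^ 2 + v - 1 = 0" using u by algebra
  have "(X - w * Y) * (X - w ^ 4 * Y) = X ^ 2 - u * X * Y + (w * w ^ 4) * Y ^ 2"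
    unfolding u_def by (simp add: algebra_simps power2_eq_square)
  hence 1: "(X - w * Y) * (X - w ^ 4 * Y) = X ^ 2 - u * X * Y + Y ^ 2" by (simp only: w5 mult_1)
  have "(X - w ^ 2 * Y) * (X - w ^ 3 * Y) = X ^ 2 - v * X * Y + (w ^ 2 * w ^ 3) * Y ^ 2"
    unfolding v_def by (simp add: algebra_simps power2_eq_square)
  hence 2: "(X - w ^ 2 * Y) * (X - w ^ 3 * Y) = X ^ 2 - v * X * Y + Y ^ 2" by (simp only: w5 mult_1)
  have "(X - Y) * ((X ^ 2 - u * X * Y + Y ^ 2) * (X ^ 2 - v * X * Y + Y ^ 2)) - (X ^ 5 - Y ^ 5)
      = - (v ^ 2 + v - 1) * X ^ 2 * Y ^ 2 * (X - Y)"
    unfolding u by (simp add: algebra_simps eval_nat_numeral)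
  hence "(X - Y) * ((X ^ 2 - u * X * Y + Y ^ 2) * (X ^ 2 - v * X * Y + Y ^ 2)) = X ^ 5 - Y ^ 5"
    unfolding uv by simp
  hence "(X - Y) * (((X - w * Y) * (X - w ^ 4 * Y)) * ((X - w ^ 2 * Y) * (X - w ^ 3 * Y))) = X ^ 5 - Y ^ 5"
    by (simp only: 1 2)
  thus ?thesis by (simp add: lessThan_5 mult_ac)
qed

lemma root5_power:
  assumes "root5 w" "\<not> 5 dvd k"
  shows "root5 (w ^ k)"
  unfolding root5_def
proof
  have w5: "w ^ 5 = 1" using assms by (simp add: root5_def)
  show "(w ^ k) ^ 5 = 1"
    by (metis w5 power_mult mult.commute power_one)
  have red: "w ^ k = w ^ (k mod 5)"
    by (metis w5 div_mult_mod_eq power_add power_mult mult.commute power_one mult_1)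
  have "k mod 5 < 5" "k mod 5 \<noteq> 0" using assms(2) by (auto simp: dvd_eq_mod_eq_0)
  hence "k mod 5 = 1 \<or> k mod 5 = 2 \<or> k mod 5 = 3 \<or> k mod 5 = 4" by linarith
  moreover have "w \<noteq> 1" using assms by (simp add: root5_def)
  moreover have "w ^ 2 \<noteq> 1" "w ^ 3 \<noteq> 1" "w ^ 4 \<noteq> 1"
  proof -
    \<comment> \<open>Each identity turns \<open>w^k = 1\<close> together with
      \<open>w^5 = 1\<close> into \<open>w = 1\<close>.\<close>
    have *: "w ^ 5 = (w ^ 2) ^ 2 * w" "w ^ 5 * w = (w ^ 3) ^ 2" "w ^ 5 = w ^ 4 * w"
      by (simp_all add: eval_nat_numeral)
    show "w ^ 2 \<noteq> 1"
    proof
      assume "w ^ 2 = 1"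
      with *(1) w5 \<open>w \<noteq> 1\<close> show False by (simp only: power_one mult_1)
    qed
    show "w ^ 3 \<noteq> 1"
    proof
      assume "w ^ 3 = 1"
      with *(2) w5 \<open>w \<noteq> 1\<close> show False by (simp only: power_one mult_1)
    qed
    show "w ^ 4 \<noteq> 1"
    proof
      assume "w ^ 4 = 1"
      with *(3) w5 \<open>w \<noteq> 1\<close> show False by (simp only: power_one mult_1)
    qed
  qed
  ultimately show "w ^ k \<noteq> 1" using red by fastforce
qed

lemma qpoch_root5_prod:
  assumes "root5 w" "norm q < 1"
  shows "(\<Prod>j<5. qpoch (w ^ j * a) q) = qpoch (a ^ 5) (q ^ 5)"
proof (rule LIMSEQ_unique)
  have q5: "norm (q ^ 5) < 1"
    using assms by (simp add: norm_power power_less_one_iff)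
  have "(\<Prod>j<5. \<Prod>n<N. 1 - w ^ j * a * q ^ n) = (\<Prod>n<N. 1 - a ^ 5 * (q ^ 5) ^ n)" for N
  proof -
    have "(\<Prod>j<5. \<Prod>n<N. 1 - w ^ j * a * q ^ n) = (\<Prod>n<N. \<Prod>j<5. 1 - w ^ j * (a * q ^ n))"
      by (subst prod.swap) (simp add: mult_ac)
    also have "\<dots> = (\<Prod>n<N. 1 - a ^ 5 * (q ^ 5) ^ n)"
      using root5_prod[OF assms(1), of 1]
      by (simp only: power_one power_mult_distrib power_mult[symmetric] mult.commute[of 5])
    finally show ?thesis .
  qed
  moreover have "(\<lambda>N. \<Prod>j<5. \<Prod>n<N. 1 - w ^ j * a * q ^ n) \<longlonglongrightarrow> (\<Prod>j<5. qpoch (w ^ j * a) q)"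
    by (intro tendsto_prod qpoch_tendsto assms)
  ultimately show "(\<lambda>N. \<Prod>n<N. 1 - a ^ 5 * (q ^ 5) ^ n) \<longlonglongrightarrow> (\<Prod>j<5. qpoch (w ^ j * a) q)"
    by simp
  show "(\<lambda>N. \<Prod>n<N. 1 - a ^ 5 * (q ^ 5) ^ n) \<longlonglongrightarrow> qpoch (a ^ 5) (q ^ 5)"
    by (rule qpoch_tendsto[OF q5])
qed

section \<open>Euler's product and the Rogers-Ramanujan products\<close>

definition euler_prod :: "complex \<Rightarrow> complex" where
  "euler_prod x = qpoch x x"

text \<open>Exponents congruent to 1 or 4 modulo 5; \<open>rr_den\<close> takes 2 and 3. The
  quotient is the Rogers-Ramanujan product for \<open>R\<close> without the fifth root of the
  nome.\<close>

definition rr_num :: "complex \<Rightarrow> complex" where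
  "rr_num x = qpoch x (x ^ 5) * qpoch (x ^ 4) (x ^ 5)"

definition rr_den :: "complex \<Rightarrow> complex" where
  "rr_den x = qpoch (x ^ 2) (x ^ 5) * qpoch (x ^ 3) (x ^ 5)"

lemma norm_power_less_1:
  fixes x :: complex
  assumes "norm x < 1" "k > 0"
  shows "norm (x ^ k) < 1"
  using assms by (simp add: norm_power power_less_one_iff)

lemma euler_prod_nonzero: "norm x < 1 \<Longrightarrow> euler_prod x \<noteq> 0"
  and rr_num_nonzero: "norm x < 1 \<Longrightarrow> rr_num x \<noteq> 0"
  and rr_den_nonzero: "norm x < 1 \<Longrightarrow> rr_den x \<noteq> 0"
  by (auto simp: euler_prod_def rr_num_def rr_den_def qpoch_nonzero norm_power_less_1)

lemma euler_prod_split5: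
  assumes "norm x < 1"
  shows "euler_prod x = rr_num x * rr_den x * euler_prod (x ^ 5)"
  unfolding euler_prod_def rr_num_def rr_den_def
proof -
  have "x * x = x ^ 2" "x * x ^ 2 = x ^ 3" "x * x ^ 3 = x ^ 4" "x * x ^ 4 = x ^ 5"
    by (simp_all add: eval_nat_numeral)
  thus "qpoch x x = qpoch x (x ^ 5) * qpoch (x ^ 4) (x ^ 5) * (qpoch (x ^ 2) (x ^ 5) * qpoch (x ^ 3) (x ^ 5)) *
        qpoch (x ^ 5) (x ^ 5)"
    by (subst qpoch_split5[OF assms]) (simp add: lessThan_5 mult_ac)
qed

text \<open>The five nomes share the fifth power \<open>x^5\<close>. After splitting modulo 5, an
  exponent prime to 5 meets every fifth root of unity once, so its product collapses to nome
  \<open>x^25\<close> and \<open>c\<close> disappears through \<open>c^5 = 1\<close>; an exponent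
  divisible by 5 does not see \<open>z^j\<close> and simply occurs five times.\<close>

lemma qpoch_nome_prod:
  assumes z: "root5 z" and c: "c ^ 5 = 1" and x: "norm x < 1"
  shows "(\<Prod>j<5. qpoch (c * (z ^ j * x)) (z ^ j * x))
           = rr_num (x ^ 5) * rr_den (x ^ 5) * qpoch (c * x ^ 5) (x ^ 5) ^ 5"
proof -
  have z5: "z ^ 5 = 1" using z by (simp add: root5_def)
  have nz: "norm z = 1"
  proof -
    have "norm z ^ 5 = 1" using z5 by (metis norm_power norm_one)
    thus ?thesis using power_eq_iff_eq_base[of 5 "norm z" 1] by simp
  qed
  have x5: "norm (x ^ 5) < 1" using x by (simp add: norm_power_less_1)
  have zx: "norm (z ^ j * x) < 1" for j
    using x nz by (simp add: norm_mult norm_power)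
  have zx5: "(z ^ j * x) ^ 5 = x ^ 5" for j
    by (simp only: power_mult_distrib power_mult[symmetric] mult.commute[of j])
       (simp only: power_mult z5 power_one mult_1)
  have "(\<Prod>j<5. qpoch (c * (z ^ j * x)) (z ^ j * x))
      = (\<Prod>j<5. \<Prod>i<5. qpoch (c * (z ^ j * x) ^ Suc i) (x ^ 5))"
  proof (rule prod.cong[OF refl])
    fix j
    show "qpoch (c * (z ^ j * x)) (z ^ j * x) = (\<Prod>i<5. qpoch (c * (z ^ j * x) ^ Suc i) (x ^ 5))"
      using qpoch_split5[OF zx, of "c * (z ^ j * x)" j] unfolding zx5 by (simp only: power_Suc mult.assoc)
  qed
  also have "\<dots> = (\<Prod>i<5. \<Prod>j<5. qpoch (c * (z ^ j * x) ^ Suc i) (x ^ 5))"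
    by (rule prod.swap)
  also have "\<dots> = (\<Prod>i<5. if i = 4 then qpoch (c * x ^ 5) (x ^ 5) ^ 5
                          else qpoch ((x ^ 5) ^ Suc i) ((x ^ 5) ^ 5))"
  proof (rule prod.cong[OF refl])
    fix i :: nat assume i: "i \<in> {..<5}"
    show "(\<Prod>j<5. qpoch (c * (z ^ j * x) ^ Suc i) (x ^ 5))
        = (if i = 4 then qpoch (c * x ^ 5) (x ^ 5) ^ 5 else qpoch ((x ^ 5) ^ Suc i) ((x ^ 5) ^ 5))"
    proof (cases "i = 4")
      case True
      hence "Suc i = 5" by simp
      show ?thesis unfolding \<open>Suc i = 5\<close> zx5 using True by simp
    next
      case False
      hence "\<not> 5 dvd Suc i" using i by (auto dest!: dvd_imp_le)
      hence r: "root5 (z ^ Suc i)" by (rule root5_power[OF z])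
      have *: "c * (z ^ j * x) ^ Suc i = (z ^ Suc i) ^ j * (c * x ^ Suc i)" for j
        by (simp only: power_mult_distrib power_mult[symmetric] mult.commute[of j] mult.left_commute)
      have **: "(c * x ^ Suc i) ^ 5 = (x ^ 5) ^ Suc i"
        by (simp only: power_mult_distrib c power_mult[symmetric] mult.commute[of 5] mult_1)
      from qpoch_root5_prod[OF r x5, of "c * x ^ Suc i"] False show ?thesis
        unfolding * ** by (simp only: if_False)
    qed
  qed
  also have "\<dots> = rr_num (x ^ 5) * rr_den (x ^ 5) * qpoch (c * x ^ 5) (x ^ 5) ^ 5"
    by (simp add: lessThan_5 rr_num_def rr_den_def numeral_2_eq_2[symmetric] numeral_3_eq_3[symmetric])
  finally show ?thesis .
qed

text \<open>Holomorphy is needed for the derivative of \<open>rr_quot\<close> and for continuity at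
  0, where the invariant quotient is evaluated. A geometric majorant on small closed discs gives
  locally uniform convergence.\<close>

lemma qpoch_powers_holomorphic:
  assumes "m > 0"
  shows "(\<lambda>x. qpoch (x ^ k) (x ^ m)) holomorphic_on ball 0 1"
proof (rule holomorphic_uniform_sequence[where f = "\<lambda>N x. \<Prod>n<N. 1 - x ^ k * (x ^ m) ^ n"])
  fix x :: complex assume x: "x \<in> ball 0 1"
  define r where "r = (1 + norm x) / 2"
  have r: "norm x < r" "r < 1" "r > 0" using x by (auto simp: r_def add_pos_nonneg)
  define d where "d = r - norm x"
  have d: "d > 0" using r by (simp add: d_def)
  have sub: "norm y \<le> r" if "y \<in> cball x d" for y
  proof -
    have "norm y \<le> norm x + norm (y - x)" by (metis add_diff_cancel_left' diff_add_cancel norm_triangle_ineq add.commute)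
    also have "norm (y - x) \<le> d" using that by (simp add: dist_norm norm_minus_commute)
    finally show ?thesis by (simp add: d_def)
  qed
  have bnd: "norm (y ^ k * (y ^ m) ^ n) \<le> r ^ n" if "y \<in> cball x d" for y n
  proof -
    have y: "norm y \<le> r" using sub that by auto
    have "norm (y ^ k * (y ^ m) ^ n) = norm y ^ k * (norm y ^ m) ^ n"
      by (simp add: norm_mult norm_power)
    also have "\<dots> \<le> 1 * (norm y ^ 1) ^ n"
      using y r assms
      by (intro mult_mono power_mono power_decreasing power_le_one) auto
    also have "\<dots> \<le> r ^ n" using y by (simp add: power_mono)
    finally show ?thesis .
  qed
  have "uniformly_convergent_on (cball x d) (\<lambda>N y. \<Prod>n<N. 1 - y ^ k * (y ^ m) ^ n)"
  proof (rule uniformly_convergent_on_prod')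
    show "uniformly_convergent_on (cball x d) (\<lambda>N y. \<Sum>n<N. norm (1 - y ^ k * (y ^ m) ^ n - 1))"
      by (rule Weierstrass_m_test'[where M = "\<lambda>n. r ^ n"])
         (use bnd r in \<open>auto intro: summable_geometric\<close>)
  qed (auto intro!: continuous_intros)
  then obtain l where l: "uniform_limit (cball x d) (\<lambda>N y. \<Prod>n<N. 1 - y ^ k * (y ^ m) ^ n) l sequentially"
    by (auto simp: uniformly_convergent_on_def)
  have "l y = qpoch (y ^ k) (y ^ m)" if "y \<in> cball x d" for y
  proof (rule LIMSEQ_unique)
    show "(\<lambda>N. \<Prod>n<N. 1 - y ^ k * (y ^ m) ^ n) \<longlonglongrightarrow> l y"
      by (rule tendsto_uniform_limitI[OF l that])
    show "(\<lambda>N. \<Prod>n<N. 1 - y ^ k * (y ^ m) ^ n) \<longlonglongrightarrow> qpoch (y ^ k) (y ^ m)"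
      by (rule qpoch_tendsto) (use sub[OF that] r assms in \<open>auto intro!: norm_power_less_1\<close>)
  qed
  with l have "uniform_limit (cball x d) (\<lambda>N y. \<Prod>n<N. 1 - y ^ k * (y ^ m) ^ n)
      (\<lambda>y. qpoch (y ^ k) (y ^ m)) sequentially"
    by (metis (no_types, lifting) uniform_limit_cong')
  thus "\<exists>d>0. cball x d \<subseteq> ball 0 1 \<and>
      uniform_limit (cball x d) (\<lambda>N x. \<Prod>n<N. 1 - x ^ k * (x ^ m) ^ n)
         (\<lambda>x. qpoch (x ^ k) (x ^ m)) sequentially"
    using d sub r by (intro exI[of _ d]) force
qed (auto intro!: holomorphic_intros)

lemma euler_prod_holomorphic: "euler_prod holomorphic_on ball 0 1"
  using qpoch_powers_holomorphic[of 1 1] by (simp add: euler_prod_def[abs_def])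

lemma rr_num_holomorphic: "rr_num holomorphic_on ball 0 1"
  unfolding rr_num_def[abs_def]
  using qpoch_powers_holomorphic[of 5 1] qpoch_powers_holomorphic[of 5 4]
  by (auto intro!: holomorphic_intros)

lemma rr_den_holomorphic: "rr_den holomorphic_on ball 0 1"
  unfolding rr_den_def[abs_def]
  using qpoch_powers_holomorphic[of 5 2] qpoch_powers_holomorphic[of 5 3]
  by (auto intro!: holomorphic_intros)

section \<open>Jacobi triple product\<close>

definition qfact :: "nat \<Rightarrow> complex \<Rightarrow> complex" where
  "qfact n q = (\<Prod>k<n. 1 - q * q ^ k)"

text \<open>Gaussian binomial coefficient. For \<open>j > m\<close> truncated subtraction does not
  produce 0, so the recurrence is restricted to \<open>j < m\<close> and the ends of the sums are
  treated separately.\<close>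

definition qbinom :: "nat \<Rightarrow> nat \<Rightarrow> complex \<Rightarrow> complex" where
  "qbinom m j q = qfact m q / (qfact j q * qfact (m - j) q)"

lemma qfact_0 [simp]: "qfact 0 q = 1"
  by (simp add: qfact_def)

lemma qfact_Suc: "qfact (Suc n) q = qfact n q * (1 - q ^ Suc n)"
  by (simp add: qfact_def)

lemma one_minus_qpower_nonzero:
  fixes q :: complex
  assumes "norm q < 1"
  shows "1 - q ^ Suc n \<noteq> 0"
proof -
  have "norm (q ^ Suc n) < 1" by (rule norm_power_less_1[OF assms]) simp
  thus ?thesis by auto
qed

lemma qfact_nonzero: "norm q < 1 \<Longrightarrow> qfact n q \<noteq> 0"
  by (induction n) (use one_minus_qpower_nonzero in \<open>auto simp: qfact_Suc simp del: power_Suc\<close>)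

lemma qbinom_Suc:
  assumes "norm q < 1" "j < m"
  shows "qbinom (Suc m) (Suc j) q = qbinom m (Suc j) q + q ^ (m - j) * qbinom m j q"
proof -
  obtain d where d: "m = Suc (j + d)" using assms(2) less_imp_Suc_add by auto
  \<comment> \<open>In these variables \<open>q^(m+1) = (1 - U) (1 - V)\<close>, and the q-Pascal
    rule becomes \<open>1 - (1 - U) (1 - V) = U + (1 - U) V\<close>.\<close>
  define P a b U V where "P = qfact m q" and "a = qfact j q" and "b = qfact d q"
    and "U = 1 - q ^ Suc d" and "V = 1 - q ^ Suc j"
  note defs = P_def a_def b_def U_def V_def
  have nz: "a \<noteq> 0" "b \<noteq> 0" "U \<noteq> 0" "V \<noteq> 0"
    unfolding defs by (rule qfact_nonzero[OF assms(1)] one_minus_qpower_nonzero[OF assms(1)])+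
  have "Suc m = Suc j + Suc d" using d by simp
  hence "q ^ Suc m = (1 - U) * (1 - V)"
    by (simp only: power_add defs) (simp only: mult.commute diff_diff_eq2 add_diff_cancel_left')
  hence e1: "qbinom (Suc m) (Suc j) q = P * (1 - (1 - U) * (1 - V)) / (a * V * (b * U))"
    by (simp only: qbinom_def qfact_Suc diff_Suc_Suc) (simp add: d qfact_Suc defs del: power_Suc)
  have e2: "qbinom m (Suc j) q = P / (a * V * b)"
    by (simp add: qbinom_def d qfact_Suc defs del: power_Suc)
  have e3: "qbinom m j q = P / (a * (b * U))"
    by (simp add: qbinom_def d Suc_diff_le qfact_Suc defs del: power_Suc)
  have e4: "q ^ (m - j) = 1 - U" using d by (simp add: defs del: power_Suc)
  show ?thesis unfolding e1 e2 e3 e4 using nz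
    by (simp add: divide_simps) (simp add: algebra_simps)
qed

lemma qbinom_0 [simp]: "norm q < 1 \<Longrightarrow> qbinom m 0 q = 1"
  and qbinom_self [simp]: "norm q < 1 \<Longrightarrow> qbinom m m q = 1"
  by (simp_all add: qbinom_def qfact_nonzero)

text \<open>Rothe's identity. In the inductive step the q-Pascal rule splits off
  \<open>- a q^m\<close> times the old sum, because \<open>q^j * q^(m-j)\<close> does not depend on
  \<open>j\<close>.\<close>

lemma qbinomial_theorem:
  assumes q: "norm q < 1"
  shows "(\<Prod>k<m. 1 - a * q ^ k) = (\<Sum>j\<le>m. (- a) ^ j * q ^ (j * (j - 1) div 2) * qbinom m j q)"
proof (induction m)
  case 0
  show ?case using q by simp
next
  case (Suc m)
  define T where "T = (\<lambda>j. (- a) ^ j * q ^ (j * (j - 1) div 2))"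
  have T_Suc: "T (Suc j) = - a * q ^ j * T j" for j
  proof -
    have "Suc j * (Suc j - 1) div 2 = j + j * (j - 1) div 2"
      by (cases j) (auto simp: algebra_simps)
    thus ?thesis by (simp add: T_def power_add del: diff_Suc_1)
  qed
  have "(\<Sum>j\<le>Suc m. T j * qbinom (Suc m) j q)
      = 1 + (\<Sum>j<m. T (Suc j) * qbinom (Suc m) (Suc j) q) + T (Suc m)"
    by (subst sum.atMost_Suc_shift, subst lessThan_Suc_atMost[symmetric])
       (use q in \<open>simp add: T_def\<close>)
  also have "(\<Sum>j<m. T (Suc j) * qbinom (Suc m) (Suc j) q)
      = (\<Sum>j<m. T (Suc j) * qbinom m (Suc j) q) + (\<Sum>j<m. - a * q ^ m * (T j * qbinom m j q))"
    unfolding sum.distrib[symmetric]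
  proof (rule sum.cong[OF refl])
    fix j assume "j \<in> {..<m}"
    hence j: "j < m" by simp
    hence "q ^ j * q ^ (m - j) = q ^ m" by (simp flip: power_add)
    thus "T (Suc j) * qbinom (Suc m) (Suc j) q
        = T (Suc j) * qbinom m (Suc j) q + - a * q ^ m * (T j * qbinom m j q)"
      unfolding qbinom_Suc[OF q j] T_Suc by (simp add: algebra_simps)
  qed
  also have "1 + ((\<Sum>j<m. T (Suc j) * qbinom m (Suc j) q) + (\<Sum>j<m. - a * q ^ m * (T j * qbinom m j q))) + T (Suc m)
     = (1 + (\<Sum>j<m. T (Suc j) * qbinom m (Suc j) q)) - a * q ^ m * ((\<Sum>j<m. T j * qbinom m j q) + T m)"
    by (simp add: T_Suc sum_distrib_left algebra_simps sum_negf)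
  also have "1 + (\<Sum>j<m. T (Suc j) * qbinom m (Suc j) q) = (\<Sum>j\<le>m. T j * qbinom m j q)"
    using q by (subst sum.atMost_shift) (simp add: T_def)
  also have "(\<Sum>j<m. T j * qbinom m j q) + T m = (\<Sum>j\<le>m. T j * qbinom m j q)"
    using q by (simp flip: lessThan_Suc_atMost)
  also have "(\<Sum>j\<le>m. T j * qbinom m j q) = (\<Prod>k<m. 1 - a * q ^ k)"
    using Suc.IH by (simp add: T_def)
  finally show ?case by (simp add: T_def algebra_simps)
qed

text \<open>The general term of the theta series; the exponent \<open>n (n - 1) / 2\<close> is a natural number for
  every integer \<open>n\<close>, so \<open>powi\<close> on \<open>q\<close> never inverts.\<close>

definition theta_term :: "complex \<Rightarrow> complex \<Rightarrow> int \<Rightarrow> complex" where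
  "theta_term z q n = (- z) powi n * q powi (n * (n - 1) div 2)"

lemma theta_term_0 [simp]: "theta_term z q 0 = 1"
  by (simp add: theta_term_def)

lemma theta_term_Suc:
  assumes "z \<noteq> 0" "q \<noteq> 0"
  shows "theta_term z q (n + 1) = theta_term z q n * (- z * q powi n)"
proof -
  have "(n + 1) * n = n * (n - 1) + n * 2" by (simp add: algebra_simps)
  hence "(n + 1) * n div 2 = n * (n - 1) div 2 + n"
    using div_mult_self1[of 2 "n * (n - 1)" n] by simp
  thus ?thesis using assms by (simp add: theta_term_def power_int_add mult_ac)
qed

text \<open>Reduces the negative half of the bilateral series to a series over the naturals, both
  for summability and for the comparison with the continued fraction.\<close>

lemma theta_term_neg:
  assumes "z \<noteq> 0" "q \<noteq> 0"
  shows "theta_term z q (- int m) = theta_term (q / z) q (int m)"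
proof (induction m)
  case (Suc m)
  have "theta_term z q (- int (Suc m)) * (- z * q powi (- int (Suc m))) = theta_term (q / z) q (int m)"
    using theta_term_Suc[OF assms, of "- int (Suc m)"] Suc.IH by simp
  moreover have "q powi (- int (Suc m)) = inverse (q * q ^ m)"
    by (simp only: power_int_minus power_int_of_nat power_Suc)
  ultimately have "theta_term z q (- int (Suc m)) * (- z * inverse (q * q ^ m)) = theta_term (q / z) q (int m)"
    by simp
  hence "theta_term z q (- int (Suc m)) = theta_term (q / z) q (int m) * (- (q / z) * q powi (int m))"
    using assms by (simp add: field_simps) (subst equation_minus_iff, simp)
  thus ?case using theta_term_Suc[of "q / z" q "int m"] assms by (simp add: add.commute)
qed simp

lemma prod_lessThan_add:
  fixes f :: "nat \<Rightarrow> 'a :: comm_monoid_mult"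
  shows "(\<Prod>k<m + n. f k) = (\<Prod>k<m. f k) * (\<Prod>k<n. f (m + k))"
  by (induction n) (simp_all add: mult_ac)

text \<open>The q-binomial theorem for \<open>2 N\<close> factors with \<open>a = z / q^N\<close>.
  The first \<open>N\<close> factors contain negative powers of \<open>q\<close>; pulling
  \<open>- z / q^(k+1)\<close> out of each turns them into the factors with \<open>q / z\<close>,
  and \<open>D\<close> collects what is pulled out.\<close>

lemma triple_product_finite:
  assumes q: "norm q < 1" "q \<noteq> 0" and z: "z \<noteq> 0"
  shows "(\<Prod>k<N. 1 - z * q ^ k) * (\<Prod>k<N. 1 - q / z * q ^ k)
    = (\<Sum>n=- int N..int N. theta_term z q n * qbinom (2 * N) (nat (n + int N)) q)"
proof -
  define D where "D = (\<Prod>k<N. - z / q ^ Suc k)"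
  have D0: "D \<noteq> 0" using q z by (simp add: D_def)
  have first: "(\<Prod>k<N. 1 - z / q ^ N * q ^ k) = D * (\<Prod>k<N. 1 - q / z * q ^ k)"
  proof -
    have "(\<Prod>k<N. 1 - z / q ^ N * q ^ k) = (\<Prod>k<N. 1 - z / q ^ N * q ^ (N - Suc k))"
      by (rule prod.nat_diff_reindex[symmetric])
    also have "\<dots> = (\<Prod>k<N. (- z / q ^ Suc k) * (1 - q / z * q ^ k))"
    proof (rule prod.cong[OF refl])
      fix k assume "k \<in> {..<N}"
      hence "q ^ N = q ^ (N - Suc k) * q ^ Suc k" by (simp flip: power_add del: power_Suc)
      hence "z / q ^ N * q ^ (N - Suc k) = z / q ^ Suc k" using q by (simp del: power_Suc)
      thus "1 - z / q ^ N * q ^ (N - Suc k) = (- z / q ^ Suc k) * (1 - q / z * q ^ k)"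
        using q z by (simp add: field_simps)
    qed
    finally show ?thesis by (simp only: prod.distrib D_def)
  qed
  have "(\<Prod>k<2 * N. 1 - z / q ^ N * q ^ k) = (\<Prod>k<N. 1 - z / q ^ N * q ^ k) * (\<Prod>k<N. 1 - z * q ^ k)"
    using q by (simp add: mult_2 prod_lessThan_add power_add)
  hence prod_eq: "(\<Prod>k<2 * N. 1 - z / q ^ N * q ^ k)
      = D * ((\<Prod>k<N. 1 - z * q ^ k) * (\<Prod>k<N. 1 - q / z * q ^ k))"
    unfolding first by (simp add: mult_ac)
  \<comment> \<open>The sum starts at \<open>n = - N\<close>, so this matches the term
    \<open>j = 0\<close>; the other terms follow from the ratio of consecutive theta terms.\<close>
  have D_eq: "D * theta_term z q (- int N) = 1"
  proof -
    have "(\<Prod>k<M. - z / q ^ Suc k) * theta_term z q (- int M) = 1" for M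
    proof (induction M)
      case (Suc M)
      have "theta_term z q (- int M) = theta_term z q (- int (Suc M)) * (- z * q powi (- int (Suc M)))"
        using theta_term_Suc[OF z q(2), of "- int (Suc M)"] by simp
      also have "- z * q powi (- int (Suc M)) = - z / q ^ Suc M"
        using q by (simp only: power_int_minus power_int_of_nat divide_inverse)
      finally show ?case using Suc.IH by (simp add: mult_ac)
    qed simp
    thus ?thesis by (simp add: D_def)
  qed
  have term_eq: "(- (z / q ^ N)) ^ j * q ^ (j * (j - 1) div 2) = D * theta_term z q (int j - int N)" for j
  proof (induction j)
    case 0
    thus ?case using D_eq by simp
  next
    case (Suc j)
    have "Suc j * (Suc j - 1) div 2 = j + j * (j - 1) div 2"
      by (cases j) (auto simp: algebra_simps)
    hence "(- (z / q ^ N)) ^ Suc j * q ^ (Suc j * (Suc j - 1) div 2)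
        = ((- (z / q ^ N)) ^ j * q ^ (j * (j - 1) div 2)) * (- z * (q ^ j / q ^ N))"
      by (simp add: power_add del: diff_Suc_1)
    also have "q ^ j / q ^ N = q powi (int j - int N)"
      using q by (simp add: power_int_diff)
    finally show ?case
      unfolding Suc.IH using theta_term_Suc[OF z q(2), of "int j - int N"]
      by (simp add: algebra_simps)
  qed
  have "D * ((\<Prod>k<N. 1 - z * q ^ k) * (\<Prod>k<N. 1 - q / z * q ^ k))
      = (\<Prod>k<2 * N. 1 - z / q ^ N * q ^ k)"
    by (rule prod_eq[symmetric])
  also have "\<dots> = (\<Sum>j\<le>2 * N. D * (theta_term z q (int j - int N) * qbinom (2 * N) j q))"
    by (simp only: qbinomial_theorem[OF q(1)] term_eq mult.assoc)
  also have "\<dots> = D * (\<Sum>j\<le>2 * N. theta_term z q (int j - int N) * qbinom (2 * N) j q)"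
    by (simp add: sum_distrib_left)
  also have "(\<Sum>j\<le>2 * N. theta_term z q (int j - int N) * qbinom (2 * N) j q)
      = (\<Sum>n=- int N..int N. theta_term z q n * qbinom (2 * N) (nat (n + int N)) q)"
    by (rule sum.reindex_bij_witness[where i = "\<lambda>n. nat (n + int N)" and j = "\<lambda>j. int j - int N"]) auto
  finally show ?thesis using D0 by simp
qed

section \<open>Passage to the limit in the finite triple product\<close>

lemma summable_theta_nat:
  assumes q: "norm q < 1" "q \<noteq> 0" and z: "z \<noteq> 0"
  shows "summable (\<lambda>n. norm (theta_term z q (int n)))"
proof -
  have "(\<lambda>n. norm z * norm q ^ n) \<longlonglongrightarrow> norm z * 0"
    using q by (intro tendsto_intros) auto
  hence "eventually (\<lambda>n. norm z * norm q ^ n < 1 / 2) sequentially"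
    by (rule order_tendstoD) simp
  then obtain K where K: "\<And>n. n \<ge> K \<Longrightarrow> norm z * norm q ^ n < 1 / 2"
    by (auto simp: eventually_at_top_linorder)
  show ?thesis
  proof (rule summable_ratio_test[of "1/2" K])
    fix n assume "n \<ge> K"
    hence "norm (theta_term z q (int n)) * (norm z * norm q ^ n) \<le> norm (theta_term z q (int n)) * (1 / 2)"
      using K[of n] by (intro mult_left_mono) auto
    moreover have "theta_term z q (int (Suc n)) = theta_term z q (int n) * (- z * q ^ n)"
      using theta_term_Suc[OF z q(2), of "int n"] by (simp add: add.commute)
    ultimately show "norm (norm (theta_term z q (int (Suc n)))) \<le> 1 / 2 * norm (norm (theta_term z q (int n)))"
      by (simp add: norm_mult norm_power mult_ac)
  qed auto
qed

lemma summable_on_theta: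
  assumes q: "norm q < 1" "q \<noteq> 0" and z: "z \<noteq> 0"
  shows "(\<lambda>n. norm (theta_term z q n)) summable_on UNIV"
proof -
  have pos: "(\<lambda>n. norm (theta_term z q n)) summable_on range int"
    by (subst summable_on_reindex)
       (auto simp: o_def summable_on_UNIV_nonneg_real_iff summable_theta_nat[OF assms])
  have "(\<lambda>n. norm (theta_term (q / z) q (int n))) summable_on UNIV"
    using summable_theta_nat[OF q, of "q / z"] q z by (simp add: summable_on_UNIV_nonneg_real_iff)
  hence neg: "(\<lambda>n. norm (theta_term z q n)) summable_on range (\<lambda>n. - int n)"
    by (subst summable_on_reindex) (auto simp: o_def inj_on_def theta_term_neg[OF z q(2)])
  have "range int \<union> range (\<lambda>n. - int n) = UNIV"
  proof -
    have "n \<in> range int \<union> range (\<lambda>n. - int n)" for n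
      by (cases n rule: int_cases2) auto
    thus ?thesis by auto
  qed
  with summable_on_union[OF pos neg] show ?thesis by simp
qed

lemma qfact_tendsto: "norm q < 1 \<Longrightarrow> (\<lambda>n. qfact n q) \<longlonglongrightarrow> euler_prod q"
  unfolding qfact_def euler_prod_def by (rule qpoch_tendsto)

text \<open>Domination for the triple product requires a bound uniform in both indices. It exists
  because \<open>qfact n q\<close> tends to a nonzero limit, so that both it and its inverse are
  bounded.\<close>

lemma qbinom_bounded:
  assumes "norm q < 1"
  obtains C where "\<And>m j. norm (qbinom m j q) \<le> C"
proof -
  have "Bseq (\<lambda>n. qfact n q)"
    by (rule convergent_imp_Bseq) (use qfact_tendsto[OF assms] in \<open>auto simp: convergent_def\<close>)
  then obtain K where K: "\<And>n. norm (qfact n q) \<le> K" by (auto simp: Bseq_def)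
  have "(\<lambda>n. inverse (qfact n q)) \<longlonglongrightarrow> inverse (euler_prod q)"
    by (intro tendsto_inverse qfact_tendsto euler_prod_nonzero assms)
  hence "Bseq (\<lambda>n. inverse (qfact n q))"
    by (intro convergent_imp_Bseq) (auto simp: convergent_def)
  then obtain L where L: "\<And>n. norm (inverse (qfact n q)) \<le> L" by (auto simp: Bseq_def)
  have pos: "K \<ge> 0" "L \<ge> 0" using K[of 0] L[of 0] norm_ge_zero order_trans by auto
  have "norm (qbinom m j q) \<le> K * (L * L)" for m j
    unfolding qbinom_def divide_inverse inverse_mult_distrib norm_mult
    using K L pos by (intro mult_mono) auto
  thus ?thesis by (rule that)
qed

text \<open>The finite form as \<open>N\<close> tends to infinity: each Gaussian binomial tends to
  \<open>1 / euler_prod q\<close>, and the uniform bound times the summable theta terms permits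
  Tannery's theorem.\<close>

theorem jacobi_triple_product:
  assumes q: "norm q < 1" "q \<noteq> 0" and z: "z \<noteq> 0"
  shows "(theta_term z q has_sum (qpoch z q * qpoch (q / z) q * euler_prod q)) UNIV"
proof -
  \<comment> \<open>\<open>int_decode\<close> enumerates the integers, making the bilateral sum an
    ordinary series. Terms outside \<open>- N..N\<close> are set to 0, since \<open>qbinom\<close>
    itself does not vanish there.\<close>
  define a where "a = (\<lambda>k N. if int_decode k \<in> {- int N..int N} then
      theta_term z q (int_decode k) * qbinom (2 * N) (nat (int_decode k + int N)) q else 0)"
  obtain C where C: "\<And>m j. norm (qbinom m j q) \<le> C" using qbinom_bounded[OF q(1)] by metis
  have C0: "C \<ge> 0" using C[of 0 0] norm_ge_zero order_trans by blast
  define M where "M = (\<lambda>k. C * norm (theta_term z q (int_decode k)))"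
  have "(\<lambda>k. norm (theta_term z q (int_decode k))) summable_on UNIV"
    using summable_on_reindex_bij_betw[OF bij_int_decode, of "\<lambda>n. norm (theta_term z q n)"]
      summable_on_theta[OF assms] by simp
  hence sum_dec: "summable (\<lambda>k. norm (theta_term z q (int_decode k)))"
    by (rule summable_on_imp_summable)
  have lim: "(\<lambda>N. a k N) \<longlonglongrightarrow> theta_term z q (int_decode k) / euler_prod q" for k
  proof -
    define n where "n = int_decode k"
    have ev: "eventually (\<lambda>N. nat \<bar>n\<bar> \<le> N) sequentially" by (rule eventually_ge_at_top)
    have l1: "(\<lambda>N. qfact (2 * N) q) \<longlonglongrightarrow> euler_prod q"
      by (rule filterlim_compose[OF qfact_tendsto[OF q(1)]])
         (auto intro!: filterlim_subseq simp: strict_mono_def)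
    have "filterlim (\<lambda>N. nat (n + int N)) at_top sequentially"
      unfolding filterlim_at_top eventually_at_top_linorder
    proof
      fix Z
      show "\<exists>M. \<forall>N\<ge>M. Z \<le> nat (n + int N)"
        by (rule exI[of _ "nat (\<bar>n\<bar> + int Z)"]) auto
    qed
    have l2: "(\<lambda>N. qfact (nat (n + int N)) q) \<longlonglongrightarrow> euler_prod q"
      by (rule filterlim_compose[OF qfact_tendsto[OF q(1)]]) fact
    have "filterlim (\<lambda>N. nat (int N - n)) at_top sequentially"
      unfolding filterlim_at_top eventually_at_top_linorder
    proof
      fix Z
      show "\<exists>M. \<forall>N\<ge>M. Z \<le> nat (int N - n)"
        by (rule exI[of _ "nat (\<bar>n\<bar> + int Z)"]) auto
    qed
    have l3: "(\<lambda>N. qfact (nat (int N - n)) q) \<longlonglongrightarrow> euler_prod q"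
      by (rule filterlim_compose[OF qfact_tendsto[OF q(1)]]) fact
    have "(\<lambda>N. theta_term z q n * (qfact (2 * N) q / (qfact (nat (n + int N)) q * qfact (nat (int N - n)) q)))
        \<longlonglongrightarrow> theta_term z q n * (euler_prod q / (euler_prod q * euler_prod q))"
      by (intro tendsto_intros l1 l2 l3) (use euler_prod_nonzero[OF q(1)] in auto)
    also have "euler_prod q / (euler_prod q * euler_prod q) = 1 / euler_prod q" by simp
    finally have "(\<lambda>N. theta_term z q n * (qfact (2 * N) q / (qfact (nat (n + int N)) q * qfact (nat (int N - n)) q)))
        \<longlonglongrightarrow> theta_term z q n / euler_prod q" by simp
    moreover have "eventually (\<lambda>N. theta_term z q n * (qfact (2 * N) q / (qfact (nat (n + int N)) q * qfact (nat (int N - n)) q)) = a k N) sequentially"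
      using ev
    proof eventually_elim
      case (elim N)
      hence "n \<in> {- int N..int N}" and "2 * N - nat (n + int N) = nat (int N - n)" by auto
      thus ?case by (simp add: a_def qbinom_def flip: n_def)
    qed
    ultimately show ?thesis unfolding n_def by (rule Lim_transform_eventually)
  qed
  have bound: "norm (a k N) \<le> M k" for k N
  proof (cases "int_decode k \<in> {- int N..int N}")
    case True
    have "norm (a k N) = norm (theta_term z q (int_decode k)) * norm (qbinom (2 * N) (nat (int_decode k + int N)) q)"
      using True by (simp add: a_def norm_mult)
    also have "\<dots> \<le> norm (theta_term z q (int_decode k)) * C"
      by (intro mult_left_mono C) auto
    finally show ?thesis by (simp add: M_def mult_ac)
  next
    case False
    hence "a k N = 0" unfolding a_def by (rule if_not_P)
    thus ?thesis using C0 by (simp add: M_def)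
  qed
  have lim1: "(\<lambda>N. \<Sum>k. a k N) \<longlonglongrightarrow> (\<Sum>k. theta_term z q (int_decode k) / euler_prod q)"
  proof -
    have "eventually (\<lambda>(k, N). norm (a k N) \<le> M k) (at_top \<times>\<^sub>F sequentially)"
      using bound by (intro always_eventually) auto
    moreover have "summable M" unfolding M_def by (rule summable_mult[OF sum_dec])
    ultimately show ?thesis
      using tannerys_theorem[of a "\<lambda>k. theta_term z q (int_decode k) / euler_prod q" sequentially M,
          OF lim _ _ sequentially_bot]
      by blast
  qed
  have fin: "(\<Sum>k. a k N) = (\<Prod>k<N. 1 - z * q ^ k) * (\<Prod>k<N. 1 - q / z * q ^ k)" for N
  proof -
    have "(\<Sum>k. a k N) = (\<Sum>k\<in>int_encode ` {- int N..int N}. a k N)"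
    proof (rule suminf_finite)
      fix k assume k: "k \<notin> int_encode ` {- int N..int N}"
      have "int_decode k \<notin> {- int N..int N}"
      proof
        assume "int_decode k \<in> {- int N..int N}"
        hence "int_encode (int_decode k) \<in> int_encode ` {- int N..int N}" by (rule imageI)
        with k show False by simp
      qed
      thus "a k N = 0" unfolding a_def by (rule if_not_P)
    qed simp
    also have "\<dots> = (\<Sum>n=- int N..int N. a (int_encode n) N)"
      by (subst sum.reindex) (auto simp: inj_int_encode)
    also have "\<dots> = (\<Sum>n=- int N..int N. theta_term z q n * qbinom (2 * N) (nat (n + int N)) q)"
      by (rule sum.cong) (auto simp: a_def)
    finally show ?thesis by (simp only: triple_product_finite[OF assms])
  qed
  have lim2: "(\<lambda>N. (\<Prod>k<N. 1 - z * q ^ k) * (\<Prod>k<N. 1 - q / z * q ^ k)) \<longlonglongrightarrow> qpoch z q * qpoch (q / z) q"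
    by (intro tendsto_mult qpoch_tendsto q)
  have eq: "(\<Sum>k. theta_term z q (int_decode k) / euler_prod q) = qpoch z q * qpoch (q / z) q"
    by (rule LIMSEQ_unique[OF lim1[unfolded fin] lim2])
  have "((\<lambda>k. theta_term z q (int_decode k)) has_sum (\<Sum>k. theta_term z q (int_decode k))) UNIV"
    by (rule norm_summable_imp_has_sum[OF sum_dec summable_sums[OF summable_norm_cancel[OF sum_dec]]])
  hence "(theta_term z q has_sum (\<Sum>k. theta_term z q (int_decode k))) UNIV"
    using has_sum_reindex_bij_betw[OF bij_int_decode, of "theta_term z q"] by simp
  moreover have "(\<Sum>k. theta_term z q (int_decode k)) = qpoch z q * qpoch (q / z) q * euler_prod q"
    using eq euler_prod_nonzero[OF q(1)] unfolding suminf_divide[OF summable_norm_cancel[OF sum_dec]]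
    by (simp add: divide_eq_eq)
  ultimately show ?thesis by simp
qed

section \<open>Modular equation of degree five\<close>

text \<open>With the representatives \<open>-1..3\<close> the parameters \<open>x^(5 i + 10)\<close>
  of the five subseries run from \<open>x^5\<close> to \<open>x^25\<close>, so no negative power of
  \<open>x\<close> arises in the products of nome \<open>x^25\<close>.\<close>

lemma has_sum_residues5:
  fixes f :: "int \<Rightarrow> complex"
  assumes "\<And>i. i \<in> {-1..3} \<Longrightarrow> ((\<lambda>m. f (5 * m + i)) has_sum s i) UNIV"
  shows "(f has_sum (\<Sum>i=-1..3. s i)) UNIV"
proof -
  have "(f has_sum (\<Sum>i=-1..3. s i)) (\<Union>i\<in>{-1..3}. range (\<lambda>m. 5 * m + i))"
  proof (rule sum_has_sum)
    fix i :: int assume "i \<in> {-1..3}"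
    thus "(f has_sum s i) (range (\<lambda>m. 5 * m + i))"
      using assms by (subst has_sum_reindex) (auto simp: o_def inj_on_def)
  next
    fix i j :: int assume "i \<in> {-1..3}" "j \<in> {-1..3}" "i \<noteq> j"
    thus "range (\<lambda>m. 5 * m + i) \<inter> range (\<lambda>m. 5 * m + j) = {}"
      by auto presburger
  qed simp
  moreover have "n \<in> (\<Union>i\<in>{-1..3}. range (\<lambda>m. 5 * m + i))" for n :: int
  proof
    have "n = 5 * ((n + 1) div 5) + ((n + 1) mod 5 - 1)" by presburger
    thus "n \<in> range (\<lambda>m. 5 * m + ((n + 1) mod 5 - 1))" by (rule range_eqI)
    have "0 \<le> (n + 1) mod 5" "(n + 1) mod 5 < 5" by simp_all
    thus "(n + 1) mod 5 - 1 \<in> {-1..3}" unfolding atLeastAtMost_iff by linarith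
  qed
  ultimately show ?thesis by (metis UNIV_eq_I)
qed

text \<open>For \<open>n = 5 m + i\<close> the exponent \<open>n (n - 1) / 2\<close> is
  \<open>25 m (m - 1) / 2 + (5 i + 10) m + i (i - 1) / 2\<close>, and \<open>(- w)^5 = - 1\<close>
  supplies the alternating sign, so each residue class is again a theta series.\<close>

lemma theta_term_residue:
  assumes w: "w ^ 5 = 1" and x: "x \<noteq> 0"
  shows "theta_term w x (5 * m + i) = theta_term w x i * theta_term (x powi (5 * i + 10)) (x ^ 25) m"
proof -
  have w0: "w \<noteq> 0" using w by auto
  have "(- w) powi (5 * m + i) = ((- w) powi 5) powi m * (- w) powi i"
    using w0 by (simp add: power_int_add power_int_mult)
  also have "(- w) powi 5 = - 1" using w by simp
  finally have sgn: "(- w) powi (5 * m + i) = (- 1) powi m * (- w) powi i" .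
  have "even (m * (m - 1))" "even (i * (i - 1))" by auto
  then obtain a b where ab: "m * (m - 1) = 2 * a" "i * (i - 1) = 2 * b" by (elim evenE)
  have "(5 * m + i) * (5 * m + i - 1) = 25 * (m * (m - 1)) + 2 * ((5 * i + 10) * m) + i * (i - 1)"
    by (simp add: algebra_simps)
  also have "\<dots> = 2 * (25 * a + (5 * i + 10) * m + b)" by (simp add: ab)
  finally have e: "(5 * m + i) * (5 * m + i - 1) div 2 = 25 * a + (5 * i + 10) * m + b" by simp
  have "x powi (25 * a + (5 * i + 10) * m + b) = (x ^ 25) powi a * (x powi (5 * i + 10)) powi m * x powi b"
    using x by (simp add: power_int_add power_int_mult)
  moreover have "(- (x powi (5 * i + 10))) powi m = (- 1) powi m * (x powi (5 * i + 10)) powi m"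
    by (simp flip: power_int_mult_distrib)
  ultimately show ?thesis
    by (simp add: theta_term_def e sgn ab)
qed

text \<open>The triple product at \<open>z = w\<close> divided by the elementary factor
  \<open>1 - w\<close>; the second parameter is \<open>w^4 = 1/w\<close>.\<close>

definition rr_theta :: "complex \<Rightarrow> complex \<Rightarrow> complex" where
  "rr_theta w x = qpoch (w * x) x * qpoch (w ^ 4 * x) x * euler_prod x"

text \<open>Class 3 drops out because its product contains \<open>qpoch 1\<close>; classes 0 and 1
  both give \<open>rr_den\<close>, classes -1 and 2 both give \<open>rr_num\<close>. Dividing by
  \<open>1 - w\<close> turns \<open>w^2 - w^4\<close> into the period
  \<open>w^2 + w^3\<close>.\<close>

lemma rr_theta_dissection:
  assumes w: "root5 w" and x: "norm x < 1" "x \<noteq> 0"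
  shows "rr_theta w x = euler_prod (x ^ 25) * (rr_den (x ^ 5) + (w ^ 2 + w ^ 3) * x * rr_num (x ^ 5))"
proof -
  have w5: "w ^ 5 = 1" and w1: "w \<noteq> 1" using w by (auto simp: root5_def)
  have w0: "w \<noteq> 0" using w5 by auto
  have w4: "w * w ^ 4 = 1" using w5 by (simp add: eval_nat_numeral)
  have winv: "inverse w = w ^ 4" by (rule inverse_unique[OF w4])
  have x25: "norm (x ^ 25) < 1" "x ^ 25 \<noteq> 0" using x by (auto simp: norm_power_less_1)
  define S where "S = (\<lambda>i::int. theta_term w x i *
    (qpoch (x powi (5 * i + 10)) (x ^ 25) * qpoch (x ^ 25 / x powi (5 * i + 10)) (x ^ 25) * euler_prod (x ^ 25)))"
  have "(theta_term w x has_sum (\<Sum>i=-1..3. S i)) UNIV"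
  proof (rule has_sum_residues5)
    fix i :: int
    have "x powi (5 * i + 10) \<noteq> 0" using x by simp
    from has_sum_cmult_right[OF jacobi_triple_product[OF x25 this], of "theta_term w x i"]
    show "((\<lambda>m. theta_term w x (5 * m + i)) has_sum S i) UNIV"
      by (simp only: theta_term_residue[OF w5 x(2)] S_def)
  qed
  from has_sum_unique[OF this jacobi_triple_product[OF x w0]]
  have "(\<Sum>i=-1..3. S i) = qpoch w x * qpoch (x / w) x * euler_prod x" .
  moreover have "x / w = w ^ 4 * x" by (simp add: divide_inverse winv mult.commute)
  moreover have "qpoch w x = (1 - w) * qpoch (w * x) x" by (rule qpoch_Suc[OF x(1)])
  ultimately have sum_eq: "(\<Sum>i=-1..3. S i) = (1 - w) * rr_theta w x" by (simp add: rr_theta_def mult_ac)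
  have "{-1..3::int} = {-1, 0, 1, 2, 3}" by auto
  hence expand: "(\<Sum>i=-1..3. S i) = S (-1) + S 0 + S 1 + S 2 + S 3" by simp
  have pw: "x powi 5 = x ^ 5" "x powi 10 = x ^ 10" "x powi 15 = x ^ 15" "x powi 20 = x ^ 20" "x powi 25 = x ^ 25"
    by simp_all
  have quot: "x ^ 25 / x ^ 5 = x ^ 20" "x ^ 25 / x ^ 10 = x ^ 15" "x ^ 25 / x ^ 15 = x ^ 10"
    "x ^ 25 / x ^ 20 = x ^ 5" "x ^ 25 / x ^ 25 = 1"
    using x by (simp_all add: power_diff[symmetric])
  have AB: "rr_num (x ^ 5) = qpoch (x ^ 5) (x ^ 25) * qpoch (x ^ 20) (x ^ 25)"
    "rr_den (x ^ 5) = qpoch (x ^ 10) (x ^ 25) * qpoch (x ^ 15) (x ^ 25)"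
    by (simp_all add: rr_num_def rr_den_def flip: power_mult)
  have tt: "theta_term w x (-1) = - (w ^ 4) * x" "theta_term w x 1 = - w" "theta_term w x 2 = w ^ 2 * x"
    by (simp_all add: theta_term_def power_int_minus winv inverse_minus_eq)
  have S: "S (-1) = - (w ^ 4) * x * (rr_num (x ^ 5) * euler_prod (x ^ 25))" "S 0 = rr_den (x ^ 5) * euler_prod (x ^ 25)"
    "S 1 = - w * (rr_den (x ^ 5) * euler_prod (x ^ 25))" "S 2 = w ^ 2 * x * (rr_num (x ^ 5) * euler_prod (x ^ 25))" "S 3 = 0"
    unfolding S_def using x25(1) x(2) by (simp_all add: pw quot AB tt)
  have "(1 - w) * rr_theta w x = (1 - w) * (rr_den (x ^ 5) * euler_prod (x ^ 25)) + (w ^ 2 - w ^ 4) * (x * rr_num (x ^ 5) * euler_prod (x ^ 25))"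
    unfolding sum_eq[symmetric] expand S by (simp add: algebra_simps)
  also have "w ^ 2 - w ^ 4 = (1 - w) * (w ^ 2 + w ^ 3)"
    by (simp add: algebra_simps eval_nat_numeral)
  finally have "(1 - w) * rr_theta w x = (1 - w) * (euler_prod (x ^ 25) * (rr_den (x ^ 5) + (w ^ 2 + w ^ 3) * x * rr_num (x ^ 5)))"
    by (simp add: algebra_simps)
  thus ?thesis using w1 by simp
qed

text \<open>The nontrivial fifth roots of unity split into \<open>w\<close>, \<open>w^4\<close> and
  \<open>w^2\<close>, \<open>w^3\<close>; one of the two factors \<open>euler_prod x\<close>
  supplies the trivial root and completes the product of \<open>qpoch_root5_prod\<close>.\<close>

lemma rr_theta_mult:
  assumes w: "root5 w" and x: "norm x < 1"
  shows "rr_theta w x * rr_theta (w ^ 2) x = euler_prod x * euler_prod (x ^ 5)"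
proof -
  have "(w ^ 2) ^ 4 = w ^ 5 * w ^ 3" by (simp add: eval_nat_numeral)
  hence w8: "(w ^ 2) ^ 4 = w ^ 3" using w by (simp only: root5_def mult_1)
  have "qpoch (x ^ 5) (x ^ 5) = qpoch x x * qpoch (w * x) x * qpoch (w ^ 2 * x) x * qpoch (w ^ 3 * x) x * qpoch (w ^ 4 * x) x"
    unfolding qpoch_root5_prod[OF w x, symmetric] by (simp add: lessThan_5 mult_ac)
  thus ?thesis unfolding rr_theta_def w8 euler_prod_def by (simp add: mult_ac)
qed

lemma rr_theta_nome_prod:
  assumes w: "root5 w" and x: "norm x < 1"
  shows "(\<Prod>j<5. rr_theta w (w ^ j * x)) = (rr_num (x ^ 5) * rr_den (x ^ 5)) ^ 3 * rr_theta w (x ^ 5) ^ 5"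
proof -
  have w5: "w ^ 5 = 1" using w by (simp add: root5_def)
  have "(w ^ 4) ^ 5 = (w ^ 5) ^ 4" by (simp flip: power_mult)
  hence w45: "(w ^ 4) ^ 5 = 1" using w5 by simp
  show ?thesis
    using qpoch_nome_prod[OF w w5 x] qpoch_nome_prod[OF w w45 x] qpoch_nome_prod[OF w _ x, of 1]
    by (simp add: rr_theta_def euler_prod_def prod.distrib power_mult_distrib power3_eq_cube mult_ac)
qed

text \<open>Both periods satisfy \<open>y^2 = 1 - y\<close>, hence \<open>y^5 = 5 y - 3\<close>.
  This is the origin of the 11, as \<open>5 (s + t) - 6 = - 11\<close>, and of the last equation,
  which later makes the constants in the logarithmic derivatives agree.\<close>

lemma root5_period_sums:
  assumes "root5 w"
  defines "s \<equiv> w ^ 2 + w ^ 3" and "t \<equiv> w + w ^ 4"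
  shows "s + t = - 1" "s * t = - 1" "s ^ 5 + t ^ 5 = - 11" "s ^ 5 * t ^ 5 = - 1"
    "s ^ 5 - t ^ 5 = 5 * (s - t)"
proof -
  show st: "s + t = - 1"
  proof -
    have "(s + t) + 1 = 0" using root5_sum[OF assms(1)] by (simp add: s_def t_def add_ac)
    thus ?thesis by (simp add: eq_neg_iff_add_eq_0)
  qed
  have w67: "w ^ 6 = w" "w ^ 7 = w ^ 2"
  proof -
    have "w ^ 6 = w ^ 5 * w" "w ^ 7 = w ^ 5 * w ^ 2" by (simp_all add: eval_nat_numeral)
    thus "w ^ 6 = w" "w ^ 7 = w ^ 2" using assms(1) by (simp_all only: root5_def mult_1)
  qed
  have "s * t = w ^ 3 + w ^ 6 + (w ^ 4 + w ^ 7)"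
    by (simp add: s_def t_def algebra_simps eval_nat_numeral)
  also have "\<dots> = s + t" by (simp add: w67 s_def t_def)
  finally show ST: "s * t = - 1" using st by simp
  have t: "t = - 1 - s" using st by (simp add: algebra_simps)
  have "s * (- 1 - s) = - 1" using ST t by simp
  hence s2: "s ^ 2 = 1 - s" by (simp add: algebra_simps power2_eq_square)
  have t2: "t ^ 2 = 1 - t" unfolding t using s2 by (simp add: power2_eq_square algebra_simps)
  have five: "y ^ 5 = 5 * y - 3" if "y ^ 2 = 1 - y" for y :: complex
  proof -
    have yy: "y * y = 1 - y" using that by (simp add: power2_eq_square)
    have "y ^ 5 = (y * y) * (y * y) * y" by (simp add: eval_nat_numeral)
    also have "\<dots> = (1 - y) * (1 - y) * y" unfolding yy ..
    also have "\<dots> = (1 - 2 * y + y * y) * y" by (simp add: algebra_simps)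
    also have "\<dots> = (2 - 3 * y) * y" unfolding yy by simp
    also have "\<dots> = 2 * y - 3 * (y * y)" by (simp add: algebra_simps)
    also have "\<dots> = 5 * y - 3" unfolding yy by (simp add: algebra_simps)
    finally show ?thesis .
  qed
  show "s ^ 5 + t ^ 5 = - 11" unfolding five[OF s2] five[OF t2] unfolding t by simp
  show "s ^ 5 - t ^ 5 = 5 * (s - t)" unfolding five[OF s2] five[OF t2] by simp
  show "s ^ 5 * t ^ 5 = - 1" using ST by (simp flip: power_mult_distrib)
qed

definition rr_quot :: "complex \<Rightarrow> complex" where
  "rr_quot q = rr_num q / rr_den q"

text \<open>The dissection is multiplied over the nomes \<open>w^j x\<close>. They share the fifth
  power \<open>q\<close>, so only the explicit factor \<open>x\<close> varies and the linear forms
  multiply to a difference of fifth powers.\<close>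

lemma rr_poly_prod:
  assumes w: "root5 w" and x: "norm x < 1" "x \<noteq> 0"
  defines "q \<equiv> x ^ 5"
  shows "euler_prod (q ^ 5) ^ 5 * (rr_den q ^ 5 + (w ^ 2 + w ^ 3) ^ 5 * q * rr_num q ^ 5)
    = (rr_num q * rr_den q) ^ 3 * rr_theta w q ^ 5"
proof -
  have w5: "w ^ 5 = 1" using w by (simp add: root5_def)
  have nw: "norm w = 1"
  proof -
    have "norm w ^ 5 = 1" using w5 by (metis norm_power norm_one)
    thus ?thesis using power_eq_iff_eq_base[of 5 "norm w" 1] by simp
  qed
  have w0: "w \<noteq> 0" using w5 by auto
  have wx: "norm (w ^ j * x) < 1" "w ^ j * x \<noteq> 0" for j
    using x nw w0 by (auto simp: norm_mult norm_power)
  have wx5: "(w ^ j * x) ^ 5 = q" for j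
    unfolding q_def
    by (simp only: power_mult_distrib power_mult[symmetric] mult.commute[of j])
       (simp only: power_mult w5 power_one mult_1)
  have wx25: "(w ^ j * x) ^ 25 = q ^ 5" for j
  proof -
    have "(w ^ j * x) ^ 25 = ((w ^ j * x) ^ 5) ^ 5" by (simp flip: power_mult)
    thus ?thesis by (simp only: wx5)
  qed
  define s where "s = w ^ 2 + w ^ 3"
  have "(rr_num q * rr_den q) ^ 3 * rr_theta w q ^ 5 = (\<Prod>j<5. rr_theta w (w ^ j * x))"
    unfolding q_def by (rule rr_theta_nome_prod[OF w x(1), symmetric])
  also have "\<dots> = (\<Prod>j<5. euler_prod (q ^ 5) * (rr_den q - w ^ j * (- (s * x * rr_num q))))"
  proof (rule prod.cong[OF refl])
    fix j
    show "rr_theta w (w ^ j * x) = euler_prod (q ^ 5) * (rr_den q - w ^ j * (- (s * x * rr_num q)))"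
      using rr_theta_dissection[OF w wx, of j] unfolding wx5 wx25 s_def by (simp add: algebra_simps)
  qed
  also have "\<dots> = euler_prod (q ^ 5) ^ 5 * (rr_den q ^ 5 - (- (s * x * rr_num q)) ^ 5)"
    by (simp only: prod.distrib root5_prod[OF w] prod_constant card_lessThan)
  also have "(- (s * x * rr_num q)) ^ 5 = - (s ^ 5 * q * rr_num q ^ 5)"
    by (simp add: q_def power_mult_distrib)
  finally show ?thesis by (simp add: s_def)
qed

section \<open>The functions z and rho, their quadratics and their derivatives\<close>

lemma exists_root5:
  fixes q :: complex
  assumes "norm q < 1" "q \<noteq> 0"
  obtains x where "norm x < 1" "x \<noteq> 0" "x ^ 5 = q"
proof -
  obtain x where x: "x ^ 5 = q" using exists_complex_root[of 5 q] by auto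
  hence "norm x ^ 5 < 1" using assms by (simp flip: norm_power)
  hence "norm x < 1" by (simp add: power_less_one_iff)
  moreover have "x \<noteq> 0" using x assms by auto
  ultimately show ?thesis using x that by blast
qed

definition rr_z :: "complex \<Rightarrow> complex" where
  "rr_z q = q * rr_quot q ^ 5"

definition rr_rho :: "complex \<Rightarrow> complex" where
  "rr_rho x = x * rr_quot (x ^ 5)"

text \<open>This is \<open>q z'(q) / z(q)\<close>, written through \<open>rr_quot\<close> so that it
  makes sense at \<open>q = 0\<close>, where \<open>z\<close> vanishes, and has the value 1
  there.\<close>

definition rr_E :: "complex \<Rightarrow> complex" where
  "rr_E q = 1 + 5 * q * (deriv rr_quot q / rr_quot q)"

lemma rr_quot_nonzero: "norm q < 1 \<Longrightarrow> rr_quot q \<noteq> 0"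
  by (simp add: rr_quot_def rr_num_nonzero rr_den_nonzero)

lemma rr_quot_holomorphic: "rr_quot holomorphic_on ball 0 1"
  unfolding rr_quot_def[abs_def]
  by (intro holomorphic_intros rr_num_holomorphic rr_den_holomorphic) (auto simp: rr_den_nonzero)

lemma rr_quot_has_field_derivative:
  assumes "norm q < 1"
  shows "(rr_quot has_field_derivative deriv rr_quot q) (at q)"
  by (rule holomorphic_derivI[OF rr_quot_holomorphic open_ball]) (use assms in simp)

lemma rr_z_has_field_derivative:
  assumes "norm q < 1"
  shows "(rr_z has_field_derivative rr_quot q ^ 5 * rr_E q) (at q)"
proof -
  have "(rr_z has_field_derivative (1 * rr_quot q ^ 5 + (5 * rr_quot q ^ 4 * deriv rr_quot q) * q)) (at q)"
    unfolding rr_z_def[abs_def]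
    by (rule derivative_eq_intros rr_quot_has_field_derivative assms refl)+ simp
  also have "1 * rr_quot q ^ 5 + (5 * rr_quot q ^ 4 * deriv rr_quot q) * q = rr_quot q ^ 5 * rr_E q"
    using rr_quot_nonzero[OF assms]
    by (simp add: rr_E_def field_simps) (simp add: eval_nat_numeral)
  finally show ?thesis .
qed

text \<open>The inner derivative of \<open>q^5\<close> contributes the same 5 that the fifth power
  contributes to \<open>rr_z\<close>; hence the same function \<open>rr_E\<close> appears, only at
  \<open>q^5\<close>.\<close>

lemma rr_rho_has_field_derivative:
  assumes "norm q < 1"
  shows "(rr_rho has_field_derivative rr_quot (q ^ 5) * rr_E (q ^ 5)) (at q)"
proof -
  have q5: "norm (q ^ 5) < 1" using assms by (simp add: norm_power_less_1)
  have "((\<lambda>q. q ^ 5) has_field_derivative (5 * q ^ 4)) (at q)"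
    by (rule derivative_eq_intros refl)+ simp
  from DERIV_chain2[OF rr_quot_has_field_derivative[OF q5] this]
  have d: "((\<lambda>q. rr_quot (q ^ 5)) has_field_derivative (deriv rr_quot (q ^ 5) * (5 * q ^ 4))) (at q)" .
  have "(rr_rho has_field_derivative (1 * rr_quot (q ^ 5) + (deriv rr_quot (q ^ 5) * (5 * q ^ 4)) * q)) (at q)"
    unfolding rr_rho_def[abs_def] by (rule DERIV_mult'[OF DERIV_ident d, THEN DERIV_cong]) simp
  also have "1 * rr_quot (q ^ 5) + (deriv rr_quot (q ^ 5) * (5 * q ^ 4)) * q = rr_quot (q ^ 5) * rr_E (q ^ 5)"
    using rr_quot_nonzero[OF q5]
    by (simp add: rr_E_def field_simps) (simp add: eval_nat_numeral)
  finally show ?thesis .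
qed

text \<open>With \<open>s = w\<^sup>2 + w\<^sup>3\<close> and \<open>t = w + w\<^sup>4\<close> this yields the factors of
  \<open>1 - 11 z - z\<^sup>2 = (1 + s\<^sup>5 z) (1 + t\<^sup>5 z)\<close> and of \<open>1 - \<rho> - \<rho>\<^sup>2 = (1 + s \<rho>) (1 + t \<rho>)\<close>.\<close>

lemma rr_z_factor:
  assumes w: "root5 w" and q: "norm q < 1" "q \<noteq> 0"
  shows "1 + (w ^ 2 + w ^ 3) ^ 5 * rr_z q
    = (rr_num q * rr_den q) ^ 3 * rr_theta w q ^ 5 / (euler_prod (q ^ 5) * rr_den q) ^ 5"
proof -
  obtain x where x: "norm x < 1" "x \<noteq> 0" "x ^ 5 = q" using exists_root5[OF q] .
  have nz: "rr_den q \<noteq> 0" "euler_prod (q ^ 5) \<noteq> 0"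
    using q by (auto simp: rr_den_nonzero euler_prod_nonzero norm_power_less_1)
  define S where "S = (w ^ 2 + w ^ 3) ^ 5"
  have "euler_prod (q ^ 5) ^ 5 * (rr_den q ^ 5 + S * q * rr_num q ^ 5) = (rr_num q * rr_den q) ^ 3 * rr_theta w q ^ 5"
    using rr_poly_prod[OF w x(1,2)] unfolding x(3) S_def .
  moreover have "rr_den q ^ 5 + S * q * rr_num q ^ 5 = rr_den q ^ 5 * (1 + S * rr_z q)"
    using nz by (simp add: rr_z_def rr_quot_def power_divide field_simps)
  ultimately have "(euler_prod (q ^ 5) * rr_den q) ^ 5 * (1 + S * rr_z q) = (rr_num q * rr_den q) ^ 3 * rr_theta w q ^ 5"
    by (simp only: power_mult_distrib mult.assoc)
  thus ?thesis using nz unfolding S_def[symmetric]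
    by (metis mult_eq_0_iff nonzero_mult_div_cancel_left power_not_zero)
qed

lemma rr_rho_factor:
  assumes w: "root5 w" and q: "norm q < 1" "q \<noteq> 0"
  shows "1 + (w ^ 2 + w ^ 3) * rr_rho q = rr_theta w q / (euler_prod (q ^ 25) * rr_den (q ^ 5))"
proof -
  have nz: "rr_den (q ^ 5) \<noteq> 0" "euler_prod (q ^ 25) \<noteq> 0"
    using q by (auto simp: rr_den_nonzero euler_prod_nonzero norm_power_less_1)
  thus ?thesis
    unfolding rr_theta_dissection[OF w q] rr_rho_def rr_quot_def by (simp add: field_simps)
qed

text \<open>Replacing \<open>w\<close> by \<open>w^2\<close> interchanges the two periods, so the
  linear factors of the quadratic are \<open>rr_z_factor\<close> at \<open>w\<close> and at
  \<open>w^2\<close>; \<open>rr_theta_mult\<close> then eliminates the theta products.\<close>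

lemma rr_z_quadratic:
  assumes q: "norm q < 1" "q \<noteq> 0" and w: "root5 w"
  shows "1 - 11 * rr_z q - rr_z q ^ 2 = euler_prod q ^ 11 / (euler_prod (q ^ 5) ^ 11 * rr_den q ^ 10)"
proof -
  note ps = root5_period_sums[OF w]
  define s t where "s = w ^ 2 + w ^ 3" and "t = w + w ^ 4"
  have w2: "root5 (w ^ 2)" by (rule root5_power[OF w]) simp
  have w5: "w ^ 5 = 1" using w by (simp add: root5_def)
  have "w ^ 6 = w ^ 5 * w" by (simp add: eval_nat_numeral)
  hence t': "(w ^ 2) ^ 2 + (w ^ 2) ^ 3 = t"
    using w5 by (simp add: t_def flip: power_mult)
  have nz: "rr_den q \<noteq> 0" "euler_prod (q ^ 5) \<noteq> 0" "rr_num q \<noteq> 0"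
    using q by (auto simp: rr_den_nonzero rr_num_nonzero euler_prod_nonzero norm_power_less_1)
  have "1 - 11 * rr_z q - rr_z q ^ 2 = 1 + (s ^ 5 + t ^ 5) * rr_z q + (s ^ 5 * t ^ 5) * rr_z q ^ 2"
    unfolding s_def t_def ps by simp
  also have "\<dots> = (1 + s ^ 5 * rr_z q) * (1 + t ^ 5 * rr_z q)"
    by (simp add: algebra_simps power2_eq_square)
  also have "\<dots> = ((rr_num q * rr_den q) ^ 3 * rr_theta w q ^ 5 / (euler_prod (q ^ 5) * rr_den q) ^ 5) *
      ((rr_num q * rr_den q) ^ 3 * rr_theta (w ^ 2) q ^ 5 / (euler_prod (q ^ 5) * rr_den q) ^ 5)"
    using rr_z_factor[OF w q] rr_z_factor[OF w2 q] unfolding t' by (simp only: s_def)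
  also have "\<dots> = (rr_num q * rr_den q) ^ 6 * (rr_theta w q * rr_theta (w ^ 2) q) ^ 5 / (euler_prod (q ^ 5) * rr_den q) ^ 10"
    by (simp add: power_mult_distrib mult_ac flip: power_add)
  also have "\<dots> = (rr_num q * rr_den q * euler_prod (q ^ 5)) ^ 6 * euler_prod q ^ 5 / (euler_prod (q ^ 5) ^ 11 * rr_den q ^ 10)"
    unfolding rr_theta_mult[OF w q(1)] using nz
    by (simp add: divide_simps power_mult_distrib)
  also have "rr_num q * rr_den q * euler_prod (q ^ 5) = euler_prod q" by (rule euler_prod_split5[OF q(1), symmetric])
  finally show ?thesis by (simp flip: power_add)
qed

lemma rr_rho_quadratic:
  assumes q: "norm q < 1" "q \<noteq> 0" and w: "root5 w"
  shows "1 - rr_rho q - rr_rho q ^ 2 = euler_prod q * euler_prod (q ^ 5) / (euler_prod (q ^ 25) * rr_den (q ^ 5)) ^ 2"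
proof -
  note ps = root5_period_sums[OF w]
  define s t where "s = w ^ 2 + w ^ 3" and "t = w + w ^ 4"
  have w2: "root5 (w ^ 2)" by (rule root5_power[OF w]) simp
  have w5: "w ^ 5 = 1" using w by (simp add: root5_def)
  have "w ^ 6 = w ^ 5 * w" by (simp add: eval_nat_numeral)
  hence t': "(w ^ 2) ^ 2 + (w ^ 2) ^ 3 = t"
    using w5 by (simp add: t_def flip: power_mult)
  have "1 - rr_rho q - rr_rho q ^ 2 = 1 + (s + t) * rr_rho q + (s * t) * rr_rho q ^ 2"
    unfolding s_def t_def ps by simp
  also have "\<dots> = (1 + s * rr_rho q) * (1 + t * rr_rho q)"
    by (simp add: algebra_simps power2_eq_square)
  also have "\<dots> = (rr_theta w q / (euler_prod (q ^ 25) * rr_den (q ^ 5))) * (rr_theta (w ^ 2) q / (euler_prod (q ^ 25) * rr_den (q ^ 5)))"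
    using rr_rho_factor[OF w q] rr_rho_factor[OF w2 q] unfolding t' by (simp only: s_def)
  also have "\<dots> = euler_prod q * euler_prod (q ^ 5) / (euler_prod (q ^ 25) * rr_den (q ^ 5)) ^ 2"
    unfolding rr_theta_mult[OF w q(1), symmetric] by (simp add: power2_eq_square)
  finally show ?thesis .
qed

lemma root5_cis: "root5 (cis (2 * pi / 5))"
proof -
  have "cis (2 * pi / 5) \<noteq> 1"
  proof
    assume "cis (2 * pi / 5) = 1"
    hence "sin (2 * pi / 5) = 0" by (simp add: complex_eq_iff)
    moreover have "sin (2 * pi / 5) > 0" by (rule sin_gt_zero) auto
    ultimately show False by simp
  qed
  moreover have "cis (2 * pi / 5) ^ 5 = 1" by (simp add: Complex.DeMoivre)
  ultimately show ?thesis by (simp add: root5_def)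
qed

text \<open>Logarithmic differentiation of the degree-five modular equation
  \<open>(1 + s\<^sup>5 z(q)) / (1 + t\<^sup>5 z(q)) = ((1 + s \<rho>(q)) / (1 + t \<rho>(q)))\<^sup>5\<close>.\<close>

lemma rr_E_modular:
  assumes q: "norm q < 1" "q \<noteq> 0"
  shows "rr_z q * rr_E q / (1 - 11 * rr_z q - rr_z q ^ 2)
    = rr_rho q * rr_E (q ^ 5) / (1 - rr_rho q - rr_rho q ^ 2)"
proof -
  define w where "w = cis (2 * pi / 5)"
  have w: "root5 w" unfolding w_def by (rule root5_cis)
  have w2: "root5 (w ^ 2)" by (rule root5_power[OF w]) simp
  have w5: "w ^ 5 = 1" using w by (simp add: root5_def)
  define s t where "s = w ^ 2 + w ^ 3" and "t = w + w ^ 4"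
  note ps = root5_period_sums[OF w, folded s_def t_def]
  have "w ^ 6 = w ^ 5 * w" by (simp add: eval_nat_numeral)
  hence t': "(w ^ 2) ^ 2 + (w ^ 2) ^ 3 = t"
    using w5 by (simp add: t_def flip: power_mult)
  have st: "s \<noteq> t"
  proof
    assume "s = t"
    with ps(1) have "t + t = - 1" by simp
    moreover have "(t + t) * (t + t) = 4 * (s * t)" using \<open>s = t\<close> by (simp add: algebra_simps)
    ultimately have "(1::complex) = - 4" unfolding ps(2) by simp
    thus False by simp
  qed
  \<comment> \<open>The factor formulas require a nonzero nome, so the identity to be differentiated
    is used on the punctured disc, an open neighbourhood of \<open>q\<close>.\<close>
  define U where "U = ball 0 1 - {0 :: complex}"
  have U: "open U" "q \<in> U" using q by (auto simp: U_def)
  have UD: "norm y < 1" "y \<noteq> 0" if "y \<in> U" for y using that by (auto simp: U_def)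
  have nz: "1 + s ^ 5 * rr_z y \<noteq> 0" "1 + t ^ 5 * rr_z y \<noteq> 0" "1 + s * rr_rho y \<noteq> 0" "1 + t * rr_rho y \<noteq> 0"
    if "y \<in> U" for y
  proof -
    note y = UD[OF that]
    have "1 - 11 * rr_z y - rr_z y ^ 2 = (1 + s ^ 5 * rr_z y) * (1 + t ^ 5 * rr_z y)"
    proof -
      have "1 - 11 * rr_z y - rr_z y ^ 2 = 1 + (s ^ 5 + t ^ 5) * rr_z y + (s ^ 5 * t ^ 5) * rr_z y ^ 2"
        unfolding ps by simp
      thus ?thesis by (simp add: algebra_simps power2_eq_square)
    qed
    moreover have "1 - 11 * rr_z y - rr_z y ^ 2 \<noteq> 0"
      unfolding rr_z_quadratic[OF y w] using y
      by (auto simp: euler_prod_nonzero rr_den_nonzero norm_power_less_1)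
    moreover have "1 - rr_rho y - rr_rho y ^ 2 = (1 + s * rr_rho y) * (1 + t * rr_rho y)"
    proof -
      have "1 - rr_rho y - rr_rho y ^ 2 = 1 + (s + t) * rr_rho y + (s * t) * rr_rho y ^ 2"
        unfolding ps by simp
      thus ?thesis by (simp add: algebra_simps power2_eq_square)
    qed
    moreover have "1 - rr_rho y - rr_rho y ^ 2 \<noteq> 0"
      unfolding rr_rho_quadratic[OF y w] using y
      by (auto simp: euler_prod_nonzero rr_den_nonzero norm_power_less_1)
    ultimately show "1 + s ^ 5 * rr_z y \<noteq> 0" "1 + t ^ 5 * rr_z y \<noteq> 0"
      "1 + s * rr_rho y \<noteq> 0" "1 + t * rr_rho y \<noteq> 0" by auto
  qed
  \<comment> \<open>The formulas at \<open>w\<close> and at \<open>w^2\<close> differ only in their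
    theta products, so the quotients reduce to \<open>rr_theta w y / rr_theta (w ^ 2) y\<close>, on
    the left to its fifth power.\<close>
  have modular: "(1 + s ^ 5 * rr_z y) / (1 + t ^ 5 * rr_z y) = ((1 + s * rr_rho y) / (1 + t * rr_rho y)) ^ 5"
    if "y \<in> U" for y
  proof -
    note y = UD[OF that]
    have n: "rr_num y \<noteq> 0" "rr_den y \<noteq> 0" "euler_prod (y ^ 5) \<noteq> 0" "euler_prod (y ^ 25) \<noteq> 0" "rr_den (y ^ 5) \<noteq> 0"
      using y by (auto simp: euler_prod_nonzero rr_num_nonzero rr_den_nonzero norm_power_less_1)
    have "(1 + s ^ 5 * rr_z y) / (1 + t ^ 5 * rr_z y) = (rr_theta w y / rr_theta (w ^ 2) y) ^ 5"
      using rr_z_factor[OF w y, folded s_def] rr_z_factor[OF w2 y, unfolded t'] n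
      by (simp add: power_divide)
    moreover have "(1 + s * rr_rho y) / (1 + t * rr_rho y) = rr_theta w y / rr_theta (w ^ 2) y"
      using rr_rho_factor[OF w y, folded s_def] rr_rho_factor[OF w2 y, unfolded t'] n by simp
    ultimately show ?thesis by simp
  qed
  define Z R Z' R' where "Z = rr_z q" and "R = rr_rho q"
    and "Z' = rr_quot q ^ 5 * rr_E q" and "R' = rr_quot (q ^ 5) * rr_E (q ^ 5)"
  note nzq = nz[OF U(2), folded Z_def R_def]
  note dz = rr_z_has_field_derivative[OF q(1), folded Z'_def]
  note dr = rr_rho_has_field_derivative[OF q(1), folded R'_def]
  define G where "G = (1 + s * R) / (1 + t * R)"
  have "((\<lambda>y. (1 + s ^ 5 * rr_z y) / (1 + t ^ 5 * rr_z y)) has_field_derivative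
      (s ^ 5 - t ^ 5) * Z' / (1 + t ^ 5 * Z) ^ 2) (at q)"
    by (rule derivative_eq_intros dz refl)+
       (use nzq in \<open>auto simp: Z_def[symmetric] power2_eq_square algebra_simps\<close>)
  hence "((\<lambda>y. ((1 + s * rr_rho y) / (1 + t * rr_rho y)) ^ 5) has_field_derivative
      (s ^ 5 - t ^ 5) * Z' / (1 + t ^ 5 * Z) ^ 2) (at q)"
    by (rule has_field_derivative_transform_within_open[OF _ U]) (rule modular)
  moreover have "((\<lambda>y. (1 + s * rr_rho y) / (1 + t * rr_rho y)) has_field_derivative
      (s - t) * R' / (1 + t * R) ^ 2) (at q)"
    by (rule derivative_eq_intros dr refl)+
       (use nzq in \<open>auto simp: R_def[symmetric] power2_eq_square algebra_simps\<close>)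
  hence "((\<lambda>y. ((1 + s * rr_rho y) / (1 + t * rr_rho y)) ^ 5) has_field_derivative
      of_nat 5 * ((s - t) * R' / (1 + t * R) ^ 2 * G ^ (5 - Suc 0))) (at q)"
    unfolding G_def R_def by (rule DERIV_power)
  ultimately have "(s ^ 5 - t ^ 5) * Z' / (1 + t ^ 5 * Z) ^ 2 = 5 * ((s - t) * R' / (1 + t * R) ^ 2 * G ^ 4)"
    by (auto dest: DERIV_unique)
  \<comment> \<open>By \<open>s^5 - t^5 = 5 (s - t)\<close> both sides carry the same nonzero
    constant.\<close>
  hence "(5 * (s - t)) * (Z' / (1 + t ^ 5 * Z) ^ 2) = (5 * (s - t)) * (R' / (1 + t * R) ^ 2 * G ^ 4)"
    by (simp only: ps(5) times_divide_eq_right times_divide_eq_left mult.assoc)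
  moreover have "5 * (s - t) \<noteq> 0" using st by simp
  ultimately have "Z' / (1 + t ^ 5 * Z) ^ 2 = R' / (1 + t * R) ^ 2 * G ^ 4"
    by (metis mult_left_cancel)
  moreover have GG: "(1 + s ^ 5 * Z) / (1 + t ^ 5 * Z) = G ^ 5"
    using modular[OF U(2)] by (simp add: Z_def R_def G_def)
  moreover have "G \<noteq> 0" using nzq by (simp add: G_def)
  \<comment> \<open>Dividing by the modular equation itself passes to logarithmic derivatives, whose
    denominators are the two quadratics.\<close>
  ultimately have "Z' / (1 + t ^ 5 * Z) ^ 2 / ((1 + s ^ 5 * Z) / (1 + t ^ 5 * Z)) = R' / (1 + t * R) ^ 2 * G ^ 4 / G ^ 5"
    by simp
  also have "R' / (1 + t * R) ^ 2 * G ^ 4 / G ^ 5 = R' / (1 + t * R) ^ 2 / G"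
  proof -
    have "X * G ^ 4 / G ^ 5 = X / G" for X
      using \<open>G \<noteq> 0\<close> by (simp add: eval_nat_numeral)
    thus ?thesis .
  qed
  finally have "Z' / ((1 + s ^ 5 * Z) * (1 + t ^ 5 * Z)) = R' / ((1 + s * R) * (1 + t * R))"
    using nzq unfolding G_def by (simp add: power2_eq_square mult.commute)
  moreover have "(1 + s ^ 5 * Z) * (1 + t ^ 5 * Z) = 1 - 11 * Z - Z ^ 2"
  proof -
    have "(1 + s ^ 5 * Z) * (1 + t ^ 5 * Z) = 1 + (s ^ 5 + t ^ 5) * Z + (s ^ 5 * t ^ 5) * Z ^ 2"
      by (simp add: algebra_simps power2_eq_square)
    thus ?thesis unfolding ps by simp
  qed
  moreover have "(1 + s * R) * (1 + t * R) = 1 - R - R ^ 2"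
  proof -
    have "(1 + s * R) * (1 + t * R) = 1 + (s + t) * R + (s * t) * R ^ 2"
      by (simp add: algebra_simps power2_eq_square)
    thus ?thesis unfolding ps by simp
  qed
  ultimately have "Z' / (1 - 11 * Z - Z ^ 2) = R' / (1 - R - R ^ 2)" by simp
  hence "q * Z' / (1 - 11 * Z - Z ^ 2) = q * R' / (1 - R - R ^ 2)"
    by (metis times_divide_eq_right)
  moreover have "q * Z' = rr_z q * rr_E q" by (simp add: Z'_def rr_z_def)
  moreover have "q * R' = rr_rho q * rr_E (q ^ 5)" by (simp add: R'_def rr_rho_def)
  ultimately show ?thesis by (simp add: Z_def R_def)
qed

text \<open>The first of the two Ramanujan identities in reciprocal form;
  \<open>euler_prod_split5\<close> trades \<open>rr_num * rr_den\<close> for Euler products.\<close>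

lemma rr_z_quotient:
  assumes q: "norm q < 1" "q \<noteq> 0"
  shows "rr_z q / (1 - 11 * rr_z q - rr_z q ^ 2) = q * euler_prod (q ^ 5) ^ 6 / euler_prod q ^ 6"
proof -
  define a b e p where "a = rr_num q" and "b = rr_den q" and "e = euler_prod q" and "p = euler_prod (q ^ 5)"
  note defs = a_def b_def e_def p_def
  have nz: "a \<noteq> 0" "b \<noteq> 0" "e \<noteq> 0" "p \<noteq> 0"
    unfolding defs using q by (auto simp: euler_prod_nonzero rr_num_nonzero rr_den_nonzero norm_power_less_1)
  have e: "e = a * b * p" unfolding defs by (rule euler_prod_split5[OF q(1)])
  have "rr_z q / (1 - 11 * rr_z q - rr_z q ^ 2) = q * (a * b) ^ 5 * p ^ 11 / e ^ 11"
    unfolding rr_z_quadratic[OF q root5_cis] unfolding rr_z_def rr_quot_def defs[symmetric] using nz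
    by (simp add: divide_simps power_mult_distrib)
  also have "\<dots> = q * p ^ 6 / e ^ 6"
  proof -
    have e11: "e ^ 11 = e ^ 6 * e ^ 5" by (simp flip: power_add)
    have "p ^ 11 = p ^ 6 * p ^ 5" by (simp flip: power_add)
    hence "q * (a * b) ^ 5 * p ^ 11 = q * p ^ 6 * (a * b * p) ^ 5"
      by (simp only: power_mult_distrib mult_ac)
    hence num: "q * (a * b) ^ 5 * p ^ 11 = q * p ^ 6 * e ^ 5" by (simp only: e)
    show ?thesis unfolding num e11
      by (rule nonzero_mult_divide_mult_cancel_right) (use nz in simp)
  qed
  finally show ?thesis unfolding defs .
qed

text \<open>Reciprocal form of \<open>1 / R(q^5) - 1 - R(q^5) = f(q) / (q f(q^25))\<close>, the
  counterpart of \<open>rr_z_quotient\<close> for the other side of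
  \<open>rr_E_modular\<close>.\<close>

lemma rr_rho_quotient:
  assumes q: "norm q < 1" "q \<noteq> 0"
  shows "rr_rho q / (1 - rr_rho q - rr_rho q ^ 2) = q * euler_prod (q ^ 25) / euler_prod q"
proof -
  have q5: "norm (q ^ 5) < 1" using q by (simp add: norm_power_less_1)
  have q25: "(q ^ 5) ^ 5 = q ^ 25" by (simp flip: power_mult)
  define A B e p r where "A = rr_num (q ^ 5)" and "B = rr_den (q ^ 5)" and "e = euler_prod q" and "p = euler_prod (q ^ 5)"
    and "r = euler_prod (q ^ 25)"
  note defs = A_def B_def e_def p_def r_def
  have nz: "A \<noteq> 0" "B \<noteq> 0" "e \<noteq> 0" "p \<noteq> 0" "r \<noteq> 0"
    unfolding defs using q by (auto simp: euler_prod_nonzero rr_num_nonzero rr_den_nonzero norm_power_less_1)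
  have p: "p = A * B * r" unfolding defs using euler_prod_split5[OF q5] by (simp only: q25)
  have "rr_rho q / (1 - rr_rho q - rr_rho q ^ 2) = q * (A * B * r) * r / (e * p)"
    unfolding rr_rho_quadratic[OF q root5_cis] unfolding rr_rho_def rr_quot_def defs[symmetric] using nz
    by (simp add: divide_simps) (simp add: power2_eq_square)
  also have "\<dots> = q * r / e" unfolding p[symmetric] using nz by simp
  finally show ?thesis unfolding defs .
qed

section \<open>Invariance under the fifth power of the nome\<close>

lemma rr_E_recursion:
  assumes q: "norm q < 1" "q \<noteq> 0"
  shows "rr_E q * euler_prod (q ^ 5) / euler_prod q ^ 5 = rr_E (q ^ 5) * euler_prod ((q ^ 5) ^ 5) / euler_prod (q ^ 5) ^ 5"
proof -
  have q25: "(q ^ 5) ^ 5 = q ^ 25" by (simp flip: power_mult)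
  define e p r where "e = euler_prod q" and "p = euler_prod (q ^ 5)" and "r = euler_prod (q ^ 25)"
  note defs = e_def p_def r_def
  have nz: "e \<noteq> 0" "p \<noteq> 0" "r \<noteq> 0"
    unfolding defs using q by (auto simp: euler_prod_nonzero norm_power_less_1)
  have "rr_E q * (rr_z q / (1 - 11 * rr_z q - rr_z q ^ 2))
      = rr_E (q ^ 5) * (rr_rho q / (1 - rr_rho q - rr_rho q ^ 2))"
    using rr_E_modular[OF q] by (simp add: mult.commute)
  hence "rr_E q * (q * p ^ 6 / e ^ 6) = rr_E (q ^ 5) * (q * r / e)" unfolding rr_z_quotient[OF q] rr_rho_quotient[OF q] defs .
  hence "q * (rr_E q * p ^ 6 / e ^ 6) = q * (rr_E (q ^ 5) * r / e)"
    by (simp only: times_divide_eq_right mult.left_commute)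
  hence "rr_E q * p ^ 6 / e ^ 6 = rr_E (q ^ 5) * r / e" using q(2) by (metis mult_left_cancel)
  \<comment> \<open>The factor \<open>e / p^5\<close> balances the powers: the left side becomes
    \<open>E p / e^5\<close> at \<open>q\<close>, the right side the same expression at
    \<open>q^5\<close>.\<close>
  hence "(rr_E q * p ^ 6 / e ^ 6) * (e / p ^ 5) = (rr_E (q ^ 5) * r / e) * (e / p ^ 5)" by simp
  moreover have "(rr_E q * p ^ 6 / e ^ 6) * (e / p ^ 5) = rr_E q * p / e ^ 5"
    using nz by (simp add: eval_nat_numeral)
  moreover have "(rr_E (q ^ 5) * r / e) * (e / p ^ 5) = rr_E (q ^ 5) * r / p ^ 5"
    using nz by simp
  ultimately show ?thesis by (simp only: e_def p_def r_def q25)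
qed

lemma isCont_0_rr: "isCont euler_prod 0" "isCont rr_E 0" "euler_prod 0 = 1" "rr_E 0 = 1"
proof -
  have h: "f holomorphic_on ball 0 1 \<Longrightarrow> isCont f 0" for f :: "complex \<Rightarrow> complex"
    using holomorphic_on_imp_continuous_on continuous_on_interior[of "ball 0 1" f 0] by simp
  show "isCont euler_prod 0" by (rule h[OF euler_prod_holomorphic])
  have "isCont rr_quot 0" "isCont (deriv rr_quot) 0"
    by (rule h rr_quot_holomorphic holomorphic_deriv open_ball)+
  thus "isCont rr_E 0" unfolding rr_E_def[abs_def]
    by (intro continuous_intros) (simp_all add: rr_quot_nonzero)
  show "euler_prod 0 = 1" by (simp add: euler_prod_def qpoch_def)
  show "rr_E 0 = 1" by (simp add: rr_E_def)
qed

theorem rr_E_eq: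
  assumes q: "norm q < 1" "q \<noteq> 0"
  shows "rr_E q * euler_prod (q ^ 5) = euler_prod q ^ 5"
proof -
  define g where "g = (\<lambda>q. rr_E q * euler_prod (q ^ 5) / euler_prod q ^ 5)"
  have qk: "norm (q ^ 5 ^ k) < 1" "q ^ 5 ^ k \<noteq> 0" for k
    using q by (auto intro!: norm_power_less_1)
  have g: "g (q ^ 5 ^ k) = g q" for k
  proof (induction k)
    case (Suc k)
    have "g (q ^ 5 ^ Suc k) = g ((q ^ 5 ^ k) ^ 5)" by (simp add: mult.commute flip: power_mult)
    also have "\<dots> = g (q ^ 5 ^ k)"
      unfolding g_def by (rule rr_E_recursion[OF qk, symmetric])
    finally show ?case using Suc.IH by simp
  qed simp
  have "isCont (\<lambda>q. euler_prod (q ^ 5)) 0"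
    by (rule isCont_o2[where g = euler_prod]) (auto simp: isCont_0_rr intro!: continuous_intros)
  hence "isCont g 0"
    unfolding g_def using isCont_0_rr by (intro continuous_intros) auto
  moreover have "(\<lambda>k. q ^ 5 ^ k) \<longlonglongrightarrow> 0"
  proof (rule filterlim_compose[OF LIMSEQ_power_zero[OF q(1)]])
    show "filterlim (\<lambda>k. 5 ^ k :: nat) at_top sequentially"
      by (rule filterlim_subseq) (simp add: strict_mono_def)
  qed
  ultimately have "(\<lambda>k. g (q ^ 5 ^ k)) \<longlonglongrightarrow> g 0"
    by (rule isCont_tendsto_compose)
  hence "g q = g 0" unfolding g by (simp add: LIMSEQ_const_iff)
  also have "g 0 = 1" by (simp add: g_def isCont_0_rr)
  finally show ?thesis using euler_prod_nonzero[OF q(1)] by (simp add: g_def divide_eq_1_iff)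
qed

section \<open>The continued fraction\<close>

text \<open>The index \<open>m\<close> is paired with \<open>- (m + 1)\<close>, the grouping in
  which the terms of \<open>rr_W\<close> and \<open>rr_V\<close> at \<open>j = 0\<close> are
  written.\<close>

lemma theta_sums:
  assumes q: "norm q < 1" "q \<noteq> 0" and z: "z \<noteq> 0"
  shows "(\<lambda>m. theta_term z q (int m) + theta_term (q / z) q (int (Suc m))) sums
    (qpoch z q * qpoch (q / z) q * euler_prod q)"
proof -
  define f where "f = theta_term z q"
  define M where "M = range (\<lambda>m. - int (Suc m))"
  have f: "(f has_sum (qpoch z q * qpoch (q / z) q * euler_prod q)) UNIV"
    unfolding f_def by (rule jacobi_triple_product[OF assms])
  hence "f summable_on X" for X
    using summable_on_subset[of f UNIV X] by (auto simp: has_sum_imp_summable)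
  hence 1: "(f has_sum infsum f (range int)) (range int)" and 2: "(f has_sum infsum f M) M"
    by (simp_all add: summable_iff_has_sum_infsum)
  have "n \<in> range int \<union> M" for n
    unfolding M_def by (cases n rule: int_cases) auto
  hence "range int \<union> M = UNIV" by auto
  moreover have "range int \<inter> M = {}" by (auto simp: M_def)
  ultimately have "(f has_sum (infsum f (range int) + infsum f M)) UNIV"
    using has_sum_Un_disjoint[OF 1 2] by simp
  hence eq: "infsum f (range int) + infsum f M = qpoch z q * qpoch (q / z) q * euler_prod q"
    using f has_sum_unique by blast
  have "((\<lambda>m. f (int m)) has_sum infsum f (range int)) UNIV"
    using 1 by (subst (asm) has_sum_reindex) (auto simp: o_def)
  moreover have "((\<lambda>m. f (- int (Suc m))) has_sum infsum f M) UNIV"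
    using 2 unfolding M_def by (subst (asm) has_sum_reindex) (auto simp: o_def inj_on_def)
  ultimately have "(\<lambda>m. f (int m) + f (- int (Suc m))) sums (infsum f (range int) + infsum f M)"
    by (intro sums_add has_sum_imp_sums)
  hence "(\<lambda>m. f (int m) + f (- int (Suc m))) sums (qpoch z q * qpoch (q / z) q * euler_prod q)"
    unfolding eq .
  thus ?thesis unfolding f_def theta_term_neg[OF z q(2)] .
qed

lemma theta_term_power:
  "theta_term (x ^ k) y (int m) = (-1) ^ m * (x ^ m) ^ k * y ^ (m * (m - 1) div 2)"
proof -
  have "int m * (int m - 1) div 2 = int (m * (m - 1) div 2)"
    by (cases m) (auto simp: zdiv_int algebra_simps)
  hence "theta_term (x ^ k) y (int m) = (- (x ^ k)) ^ m * y ^ (m * (m - 1) div 2)"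
    by (simp only: theta_term_def power_int_of_nat)
  also have "(- (x ^ k)) ^ m = (-1) ^ m * (x ^ m) ^ k"
    by (subst power_minus) (simp add: mult.commute flip: power_mult)
  finally show ?thesis .
qed

text \<open>Rogers--Ramanujan recurrence, following Hardy and Wright, section 19.14: with \<open>a = q\<^sup>j\<^sup>+\<^sup>1\<close>,
  \<open>\<Sum>r. rr_W q j r\<close> and \<open>\<Sum>r. rr_V q j r\<close> are \<open>H\<^sub>2(a)\<close> and \<open>H\<^sub>1(a)\<close> up to the factor \<open>(1 - q) \<cdots> (1 - q\<^sup>j)\<close>.\<close>

definition rr_base :: "real \<Rightarrow> nat \<Rightarrow> nat \<Rightarrow> real" where
  "rr_base q j r = (-1) ^ r * (q ^ Suc j) ^ (2 * r) * (q ^ 5) ^ (r * (r - 1) div 2)"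

text \<open>This is \<open>qfact (r + j) / qfact r\<close>; because the parameter is a power of
  \<open>q\<close>, it is a finite product without denominators.\<close>

definition rr_pf :: "real \<Rightarrow> nat \<Rightarrow> nat \<Rightarrow> real" where
  "rr_pf q j r = (\<Prod>i<j. 1 - q ^ (Suc r + i))"

definition rr_W :: "real \<Rightarrow> nat \<Rightarrow> nat \<Rightarrow> real" where
  "rr_W q j r = rr_base q j r * q ^ r * (1 - (q ^ Suc j) ^ 2 * (q ^ r) ^ 4) * rr_pf q j r"

definition rr_V :: "real \<Rightarrow> nat \<Rightarrow> nat \<Rightarrow> real" where
  "rr_V q j r = rr_base q j r * (q ^ r) ^ 2 * (1 - q ^ Suc j * (q ^ r) ^ 2) * rr_pf q j r"

definition rr_w :: "real \<Rightarrow> nat \<Rightarrow> real" where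
  "rr_w q j = (\<Sum>r. rr_W q j r)"

lemma rr_base_0 [simp]: "rr_base q j 0 = 1"
  by (simp add: rr_base_def)

lemma rr_base_Suc: "rr_base q j (Suc r) = - rr_base q j r * (q ^ Suc j) ^ 2 * (q ^ r) ^ 5"
proof -
  have "Suc r * (Suc r - 1) div 2 = r + r * (r - 1) div 2"
    by (cases r) (auto simp: algebra_simps)
  moreover have "(q ^ r) ^ 5 = (q ^ 5) ^ r" by (simp add: mult.commute flip: power_mult)
  ultimately show ?thesis
    by (simp add: rr_base_def power_add power_mult_distrib power2_eq_square mult_ac del: diff_Suc_1)
qed

lemma rr_base_Suc_param: "rr_base q (Suc j) r = rr_base q j r * (q ^ r) ^ 2"
  by (simp add: rr_base_def power_mult_distrib mult_ac flip: power_mult)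

lemma rr_pf_Suc: "rr_pf q (Suc j) r = rr_pf q j r * (1 - q ^ Suc j * q ^ r)"
  by (simp add: rr_pf_def power_add mult_ac)

lemma rr_pf_shift: "rr_pf q (Suc j) r = (1 - q ^ Suc r) * rr_pf q j (Suc r)"
  by (simp add: rr_pf_def prod.lessThan_Suc_shift del: prod.lessThan_Suc)

section \<open>Recurrence, limit and positivity of the Rogers-Ramanujan series\<close>

context
  fixes q :: real
  assumes q: "0 < q" "q < 1"
begin

lemma rr_pf_bounds: "0 \<le> rr_pf q j r" "rr_pf q j r \<le> 1"
  using q unfolding rr_pf_def
  by (auto intro!: prod_nonneg prod_le_1 power_le_one simp del: power_Suc)

lemma abs_rr_base: "\<bar>rr_base q j r\<bar> \<le> (q ^ Suc j) ^ (2 * r)"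
  using q by (auto simp: rr_base_def abs_mult power_abs intro!: mult_left_le power_le_one)

lemma abs_rr_base_le_1: "\<bar>rr_base q j r\<bar> \<le> 1"
  using q by (intro order_trans[OF abs_rr_base] power_le_one) auto

lemma rr_summable:
  assumes "\<And>r. \<bar>c r\<bar> \<le> 1"
  shows "summable (\<lambda>r. rr_base q j r * q ^ r * c r * rr_pf q j r)"
proof (rule summable_comparison_test'[of "\<lambda>r. q ^ r" 0])
  show "summable (\<lambda>r. q ^ r)" using q by (simp add: summable_geometric)
  fix r
  have "\<bar>rr_base q j r\<bar> * q ^ r * \<bar>c r\<bar> * \<bar>rr_pf q j r\<bar> \<le> 1 * q ^ r * 1 * 1"
    using q assms abs_rr_base_le_1 rr_pf_bounds by (intro mult_mono) auto
  thus "norm (rr_base q j r * q ^ r * c r * rr_pf q j r) \<le> q ^ r"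
    using q by (simp add: abs_mult)
qed

lemma abs_one_minus_le_1: "0 \<le> x \<Longrightarrow> x \<le> 1 \<Longrightarrow> \<bar>1 - x\<bar> \<le> (1::real)"
  by simp

lemma summable_rr_W: "summable (rr_W q j)"
  unfolding rr_W_def[abs_def]
  by (rule rr_summable, rule abs_one_minus_le_1) (use q in \<open>auto intro!: mult_le_one power_le_one\<close>)

lemma summable_rr_V: "summable (rr_V q j)"
proof -
  have "summable (\<lambda>r. rr_base q j r * q ^ r * (q ^ r * (1 - q ^ Suc j * (q ^ r) ^ 2)) * rr_pf q j r)"
  proof (rule rr_summable)
    fix r
    have "\<bar>q ^ r\<bar> * \<bar>1 - q ^ Suc j * (q ^ r) ^ 2\<bar> \<le> 1"
      by (intro mult_le_one abs_one_minus_le_1 abs_ge_zero)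
         (use q in \<open>auto intro!: mult_le_one power_le_one\<close>)
    thus "\<bar>q ^ r * (1 - q ^ Suc j * (q ^ r) ^ 2)\<bar> \<le> 1" by (simp only: abs_mult)
  qed
  thus ?thesis by (simp add: rr_V_def[abs_def] power2_eq_square mult_ac)
qed

text \<open>With \<open>y = q^r\<close> and \<open>a = q^(j+1)\<close> one has
  \<open>1 - a y^2 = (1 - y) + y (1 - a y)\<close>. The factor \<open>1 - a y\<close> extends
  \<open>rr_pf\<close> at its upper end; \<open>1 - y\<close> vanishes at \<open>r = 0\<close>, so
  that part may be shifted by one index, where the factor extends \<open>rr_pf\<close> at its lower
  end.\<close>

lemma suminf_rr_V: "(\<Sum>r. rr_V q j r) = rr_w q (Suc j)"
proof -
  define X Y where "X = (\<lambda>r. rr_base q j r * (q ^ r) ^ 2 * (1 - q ^ r) * rr_pf q j r)"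
    and "Y = (\<lambda>r. rr_base q j r * (q ^ r) ^ 3 * (1 - q ^ Suc j * q ^ r) * rr_pf q j r)"
  have "summable (\<lambda>r. rr_base q j r * q ^ r * (q ^ r * (1 - q ^ r)) * rr_pf q j r)"
  proof (rule rr_summable)
    fix r
    have "\<bar>q ^ r\<bar> * \<bar>1 - q ^ r\<bar> \<le> 1"
      by (intro mult_le_one abs_one_minus_le_1 abs_ge_zero) (use q in \<open>auto intro!: power_le_one\<close>)
    thus "\<bar>q ^ r * (1 - q ^ r)\<bar> \<le> 1" by (simp only: abs_mult)
  qed
  hence sX: "summable X" by (simp add: X_def power2_eq_square mult_ac)
  have XY: "rr_V q j r = X r + Y r" for r
    unfolding rr_V_def X_def Y_def by (simp add: algebra_simps power2_eq_square power3_eq_cube)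
  hence "Y = (\<lambda>r. rr_V q j r - X r)" by auto
  hence sY: "summable Y" using summable_diff[OF summable_rr_V sX] by simp
  have "(\<Sum>r. rr_V q j r) = (\<Sum>r. X r) + (\<Sum>r. Y r)"
    unfolding XY by (rule suminf_add[OF sX sY, symmetric])
  also have "(\<Sum>r. X r) = (\<Sum>r. X (Suc r))"
    using suminf_split_head[OF sX] by (simp add: X_def)
  also have "(\<Sum>r. X (Suc r)) + (\<Sum>r. Y r) = (\<Sum>r. X (Suc r) + Y r)"
    using sX sY by (intro suminf_add) (auto simp: summable_Suc_iff)
  also have "(\<lambda>r. X (Suc r) + Y r) = rr_W q (Suc j)"
  proof
    fix r
    define y a where "y = q ^ r" and "a = q ^ Suc j"
    have 1: "X (Suc r) = - rr_base q j r * a ^ 2 * y ^ 5 * (q * y) ^ 2 * rr_pf q (Suc j) r"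
      unfolding X_def rr_base_Suc rr_pf_shift y_def a_def by (simp add: mult_ac)
    have 2: "Y r = rr_base q j r * y ^ 3 * rr_pf q (Suc j) r"
      unfolding Y_def rr_pf_Suc y_def a_def by (simp add: mult_ac)
    have 3: "rr_W q (Suc j) r = rr_base q j r * y ^ 2 * y * (1 - (q * a) ^ 2 * y ^ 4) * rr_pf q (Suc j) r"
      unfolding rr_W_def rr_base_Suc_param y_def a_def by simp
    show "X (Suc r) + Y r = rr_W q (Suc j) r"
      unfolding 1 2 3 by (simp add: algebra_simps eval_nat_numeral)
  qed
  finally show ?thesis by (simp add: rr_w_def)
qed

text \<open>The same shift applied to \<open>rr_W - rr_V\<close>, now with \<open>y (1 - a^2 y^4) -
  y^2 (1 - a y^2) = y (1 - y) + a y^4 (1 - a y)\<close>. It yields \<open>a\<close> times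
  \<open>rr_V\<close> at the next level, which \<open>suminf_rr_V\<close> moves up once
  more.\<close>

lemma rr_w_rec: "rr_w q j = rr_w q (Suc j) + q ^ Suc j * rr_w q (Suc (Suc j))"
proof -
  define X Y where "X = (\<lambda>r. rr_base q j r * q ^ r * (1 - q ^ r) * rr_pf q j r)"
    and "Y = (\<lambda>r. rr_base q j r * q ^ Suc j * (q ^ r) ^ 4 * (1 - q ^ Suc j * q ^ r) * rr_pf q j r)"
  have sX: "summable X" unfolding X_def
    by (rule rr_summable, rule abs_one_minus_le_1) (use q in \<open>auto intro!: power_le_one\<close>)
  have XY: "rr_W q j r - rr_V q j r = X r + Y r" for r
    unfolding rr_W_def rr_V_def X_def Y_def by (simp add: algebra_simps eval_nat_numeral)
  hence "Y = (\<lambda>r. rr_W q j r - rr_V q j r - X r)" by auto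
  hence sY: "summable Y"
    using summable_diff[OF summable_diff[OF summable_rr_W summable_rr_V] sX] by simp
  have "rr_w q j - rr_w q (Suc j) = (\<Sum>r. rr_W q j r - rr_V q j r)"
    unfolding suminf_rr_V[symmetric] unfolding rr_w_def
    by (rule suminf_diff[OF summable_rr_W summable_rr_V])
  also have "\<dots> = (\<Sum>r. X r) + (\<Sum>r. Y r)"
    unfolding XY by (rule suminf_add[OF sX sY, symmetric])
  also have "(\<Sum>r. X r) = (\<Sum>r. X (Suc r))"
    using suminf_split_head[OF sX] by (simp add: X_def)
  also have "(\<Sum>r. X (Suc r)) + (\<Sum>r. Y r) = (\<Sum>r. X (Suc r) + Y r)"
    using sX sY by (intro suminf_add) (auto simp: summable_Suc_iff)
  also have "(\<lambda>r. X (Suc r) + Y r) = (\<lambda>r. q ^ Suc j * rr_V q (Suc j) r)"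
  proof
    fix r
    define y a where "y = q ^ r" and "a = q ^ Suc j"
    have 1: "X (Suc r) = - rr_base q j r * a ^ 2 * y ^ 5 * (q * y) * rr_pf q (Suc j) r"
      unfolding X_def rr_base_Suc rr_pf_shift y_def a_def by (simp add: mult_ac)
    have 2: "Y r = rr_base q j r * a * y ^ 4 * rr_pf q (Suc j) r"
      unfolding Y_def rr_pf_Suc y_def a_def by (simp add: mult_ac)
    have 3: "rr_V q (Suc j) r = rr_base q j r * y ^ 2 * y ^ 2 * (1 - q * a * y ^ 2) * rr_pf q (Suc j) r"
      unfolding rr_V_def rr_base_Suc_param y_def a_def by simp
    show "X (Suc r) + Y r = q ^ Suc j * rr_V q (Suc j) r"
      unfolding 1 2 3 a_def[symmetric] by (simp add: algebra_simps eval_nat_numeral)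
  qed
  also have "(\<Sum>r. q ^ Suc j * rr_V q (Suc j) r) = q ^ Suc j * rr_w q (Suc (Suc j))"
    unfolding suminf_rr_V[symmetric] by (rule suminf_mult[OF summable_rr_V])
  finally show ?thesis by simp
qed

text \<open>Terms with \<open>r > 0\<close> carry the factor \<open>(q^(j+1))^2\<close>, so only
  \<open>r = 0\<close> survives, whose \<open>rr_pf\<close> is a partial Euler product. Positivity
  of the limit drives both \<open>rr_w_pos\<close> and the convergence of the fraction.\<close>

lemma rr_w_tendsto: "rr_w q \<longlonglongrightarrow> Re (euler_prod (of_real q))"
proof -
  have nq: "norm (of_real q :: complex) < 1" using q by simp
  have "complex_of_real (rr_pf q j 0) = qfact j (of_real q)" for j
    by (simp add: rr_pf_def qfact_def)
  hence "(\<lambda>j. complex_of_real (rr_pf q j 0)) \<longlonglongrightarrow> euler_prod (of_real q)"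
    using qfact_tendsto[OF nq] by simp
  from tendsto_Re[OF this] have l1: "(\<lambda>j. rr_pf q j 0) \<longlonglongrightarrow> Re (euler_prod (of_real q))" by simp
  have qj: "(\<lambda>j. q ^ Suc j) \<longlonglongrightarrow> 0"
    using q by (intro LIMSEQ_Suc LIMSEQ_power_zero) simp
  have "(\<lambda>j. (1 - (q ^ Suc j) ^ 2) * rr_pf q j 0) \<longlonglongrightarrow> (1 - 0 ^ 2) * Re (euler_prod (of_real q))"
    by (intro tendsto_intros qj l1)
  hence l2: "(\<lambda>j. rr_W q j 0) \<longlonglongrightarrow> Re (euler_prod (of_real q))" by (simp add: rr_W_def)
  have bound: "\<bar>rr_w q j - rr_W q j 0\<bar> \<le> (q ^ Suc j) ^ 2 * (1 / (1 - q))" for j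
  proof -
    have tm: "\<bar>rr_W q j (Suc r)\<bar> \<le> (q ^ Suc j) ^ 2 * q ^ r" for r
    proof -
      have "\<bar>rr_base q j (Suc r)\<bar> \<le> (q ^ Suc j) ^ (2 * Suc r)" by (rule abs_rr_base)
      also have "\<dots> \<le> (q ^ Suc j) ^ 2"
        using q by (intro power_decreasing) (auto intro!: power_le_one simp del: power_Suc)
      finally have b: "\<bar>rr_base q j (Suc r)\<bar> \<le> (q ^ Suc j) ^ 2" .
      have c: "\<bar>1 - (q ^ Suc j) ^ 2 * (q ^ Suc r) ^ 4\<bar> \<le> 1"
        by (rule abs_one_minus_le_1) (use q in \<open>auto intro!: mult_le_one power_le_one simp del: power_Suc\<close>)
      have d: "\<bar>q ^ Suc r\<bar> \<le> q ^ r" using q by (simp add: abs_mult mult_left_le_one_le)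
      have "\<bar>rr_base q j (Suc r)\<bar> * \<bar>q ^ Suc r\<bar> * \<bar>1 - (q ^ Suc j) ^ 2 * (q ^ Suc r) ^ 4\<bar> * \<bar>rr_pf q j (Suc r)\<bar>
          \<le> (q ^ Suc j) ^ 2 * q ^ r * 1 * 1"
        using b c d rr_pf_bounds q by (intro mult_mono) auto
      thus ?thesis unfolding rr_W_def abs_mult by simp
    qed
    have geo: "(\<lambda>r. (q ^ Suc j) ^ 2 * q ^ r) sums ((q ^ Suc j) ^ 2 * (1 / (1 - q)))"
      using q by (intro sums_mult geometric_sums) simp
    have s: "summable (\<lambda>r. rr_W q j (Suc r))" using summable_rr_W by (simp add: summable_Suc_iff)
    have sa: "summable (\<lambda>r. \<bar>rr_W q j (Suc r)\<bar>)"
      by (rule summable_comparison_test'[OF sums_summable[OF geo], of 0]) (use tm in auto)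
    have "rr_w q j - rr_W q j 0 = (\<Sum>r. rr_W q j (Suc r))"
      using suminf_split_head[OF summable_rr_W] by (simp add: rr_w_def)
    also have "\<bar>\<dots>\<bar> \<le> (\<Sum>r. \<bar>rr_W q j (Suc r)\<bar>)"
      using summable_rabs[OF sa] .
    also have "\<dots> \<le> (\<Sum>r. (q ^ Suc j) ^ 2 * q ^ r)"
      by (rule suminf_le[OF tm sa sums_summable[OF geo]])
    also have "\<dots> = (q ^ Suc j) ^ 2 * (1 / (1 - q))" using geo by (simp add: sums_iff)
    finally show ?thesis .
  qed
  have "(\<lambda>j. (q ^ Suc j) ^ 2 * (1 / (1 - q))) \<longlonglongrightarrow> 0 ^ 2 * (1 / (1 - q))"
    by (intro tendsto_intros qj)
  hence "(\<lambda>j. rr_w q j - rr_W q j 0) \<longlonglongrightarrow> 0"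
    by (intro Lim_null_comparison[of "\<lambda>j. rr_w q j - rr_W q j 0" "\<lambda>j. (q ^ Suc j) ^ 2 * (1 / (1 - q))"])
       (use bound in auto)
  from tendsto_add[OF this l2] show ?thesis by simp
qed

lemma
  shows Re_euler_prod_pos: "Re (euler_prod (of_real q)) > 0"
    and euler_prod_of_real: "euler_prod (of_real q) = of_real (Re (euler_prod (of_real q)))"
proof -
  have nq: "norm (of_real q :: complex) < 1" using q by simp
  have r: "complex_of_real (rr_pf q j 0) = qfact j (of_real q)" for j
    by (simp add: rr_pf_def qfact_def)
  have l: "(\<lambda>j. complex_of_real (rr_pf q j 0)) \<longlonglongrightarrow> euler_prod (of_real q)"
    unfolding r by (rule qfact_tendsto[OF nq])
  have "Re (euler_prod (of_real q)) \<ge> 0"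
    using tendsto_Re[OF l] by (rule tendsto_lowerbound) (auto simp: rr_pf_bounds)
  moreover have im: "Im (euler_prod (of_real q)) = 0"
    using tendsto_Im[OF l] by (simp add: LIMSEQ_const_iff)
  ultimately show "Re (euler_prod (of_real q)) > 0"
    using euler_prod_nonzero[OF nq] by (auto simp: complex_eq_iff order_le_less)
  show "euler_prod (of_real q) = of_real (Re (euler_prod (of_real q)))"
    using im by (simp add: complex_eq_iff)
qed

text \<open>The coefficients of the recurrence are positive, so positivity at two consecutive large
  indices, forced by the limit, descends to all smaller ones.\<close>

lemma rr_w_pos: "rr_w q j > 0"
proof -
  have "eventually (\<lambda>j. rr_w q j > 0) sequentially"
    by (rule order_tendstoD(1)[OF rr_w_tendsto Re_euler_prod_pos])
  then obtain N where N: "\<And>j. j \<ge> N \<Longrightarrow> rr_w q j > 0" by (auto simp: eventually_at_top_linorder)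
  have "rr_w q (N - m) > 0 \<and> rr_w q (Suc (N - m)) > 0" for m
  proof (induction m)
    case (Suc m)
    show ?case
    proof (cases "m < N")
      case True
      hence eq: "N - m = Suc (N - Suc m)" by simp
      have "rr_w q (N - Suc m) = rr_w q (N - m) + q ^ (N - m) * rr_w q (Suc (N - m))"
        using rr_w_rec[of "N - Suc m"] unfolding eq .
      also have "\<dots> > 0" using Suc.IH q by (intro add_pos_pos mult_pos_pos) auto
      finally show ?thesis using Suc.IH unfolding eq by simp
    qed (use Suc.IH in simp)
  qed (use N in auto)
  from this[of "N - j"] N[of j] show ?thesis by (cases "j \<le> N") auto
qed

section \<open>Convergence of the continued fraction and its product form\<close>

lemma rr_denom_ge_1: "rr_denom q k m \<ge> 1"
proof (induction m arbitrary: k)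
  case (Suc m)
  have "0 \<le> q ^ Suc k / rr_denom q (Suc k) m"
    using q Suc.IH[of "Suc k"] by (intro divide_nonneg_nonneg) auto
  thus ?case by simp
qed simp

text \<open>The ratios of consecutive \<open>rr_w\<close> satisfy the recursion of the infinite
  fraction, and \<open>y -> 1 + q^(k+1) / y\<close> shrinks distances on
  \<open>[1, infinity)\<close> by a factor of at most \<open>q\<close>. After \<open>m\<close>
  levels the truncation has reached its innermost 1, whence the last factor.\<close>

lemma rr_denom_error:
  "\<bar>rr_denom q k m - rr_w q k / rr_w q (Suc k)\<bar> \<le> q ^ m * \<bar>1 - rr_w q (k + m) / rr_w q (Suc (k + m))\<bar>"
proof (induction m arbitrary: k)
  case (Suc m)
  define d r where "d = rr_denom q (Suc k) m" and "r = rr_w q (Suc k) / rr_w q (Suc (Suc k))"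
  have pos: "rr_w q j > 0" for j by (rule rr_w_pos)
  have nz: "rr_w q j \<noteq> 0" for j using pos[of j] by simp
  have d: "d \<ge> 1" unfolding d_def by (rule rr_denom_ge_1)
  have r1: "r \<ge> 1"
  proof -
    have "rr_w q (Suc (Suc k)) \<le> rr_w q (Suc k)"
      using rr_w_rec[of "Suc k"] pos[of "Suc (Suc (Suc k))"] q by simp
    thus ?thesis using pos[of "Suc (Suc k)"] by (simp add: r_def)
  qed
  have "rr_w q k / rr_w q (Suc k) = 1 + q ^ Suc k / r"
    unfolding rr_w_rec[of k] r_def using nz by (simp add: add_divide_distrib del: power_Suc)
  hence "\<bar>rr_denom q k (Suc m) - rr_w q k / rr_w q (Suc k)\<bar> = \<bar>q ^ Suc k / d - q ^ Suc k / r\<bar>"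
    by (simp add: d_def)
  also have "q ^ Suc k / d - q ^ Suc k / r = q ^ Suc k * (r - d) / (d * r)"
    using d r1 by (simp add: field_simps)
  also have "\<bar>\<dots>\<bar> = q ^ Suc k * \<bar>d - r\<bar> / (d * r)"
    using d r1 q by (simp add: abs_mult abs_minus_commute)
  also have "\<dots> \<le> q ^ Suc k * \<bar>d - r\<bar> / 1"
  proof (rule divide_left_mono)
    show "1 \<le> d * r" using mult_mono[OF d r1] d by simp
  qed (use q d r1 in auto)
  also have "\<dots> \<le> q * \<bar>d - r\<bar>"
    using q power_le_one[of q k] by (simp add: mult_right_mono mult_left_le)
  also have "\<bar>d - r\<bar> \<le> q ^ m * \<bar>1 - rr_w q (Suc k + m) / rr_w q (Suc (Suc k + m))\<bar>"
    unfolding d_def r_def by (rule Suc.IH)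
  finally show ?case using q by (simp add: mult_left_mono mult.assoc)
qed simp

lemma rogers_ramanujan_cf_eq_quot:
  "rogers_ramanujan_cf q = root 5 q * (rr_w q 1 / rr_w q 0)"
proof -
  define L where "L = Re (euler_prod (of_real q))"
  have L: "L > 0" unfolding L_def by (rule Re_euler_prod_pos)
  note w = rr_w_tendsto[folded L_def]
  have "(\<lambda>m. q ^ m * \<bar>1 - rr_w q m / rr_w q (Suc m)\<bar>) \<longlonglongrightarrow> 0 * \<bar>1 - L / L\<bar>"
    using q L by (intro tendsto_intros w LIMSEQ_Suc[OF w] LIMSEQ_power_zero) auto
  hence "(\<lambda>m. rr_denom q 0 m - rr_w q 0 / rr_w q 1) \<longlonglongrightarrow> 0"
    by (intro Lim_null_comparison[of "\<lambda>m. rr_denom q 0 m - rr_w q 0 / rr_w q 1"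
          "\<lambda>m. q ^ m * \<bar>1 - rr_w q m / rr_w q (Suc m)\<bar>"])
       (use rr_denom_error[of 0] in auto)
  hence "(\<lambda>m. rr_denom q 0 m) \<longlonglongrightarrow> rr_w q 0 / rr_w q 1"
    by (simp add: LIM_zero_iff)
  hence "(\<lambda>m. root 5 q / rr_denom q 0 m) \<longlonglongrightarrow> root 5 q / (rr_w q 0 / rr_w q 1)"
    using rr_w_pos[of 0] rr_w_pos[of 1] by (intro tendsto_intros) auto
  thus ?thesis unfolding rogers_ramanujan_cf_def by (simp add: limI)
qed

text \<open>At \<open>j = 0\<close> the product \<open>rr_pf\<close> is empty, which leaves the
  theta series of nome \<open>x^5\<close> at \<open>z = x^3\<close>.\<close>

lemma of_real_rr_w_0: "of_real (rr_w q 0) = rr_den (of_real q) * euler_prod (of_real q ^ 5)"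
proof -
  define x where "x = complex_of_real q"
  have x: "norm x < 1" "x \<noteq> 0" using q by (auto simp: x_def)
  have x5: "norm (x ^ 5) < 1" "x ^ 5 \<noteq> 0" using x by (auto simp: norm_power_less_1)
  have quot: "x ^ 5 / x ^ 3 = x ^ 2" using x by (simp add: power_diff[symmetric])
  have "x ^ 3 \<noteq> 0" using x by simp
  from theta_sums[OF x5 this]
  have sums: "(\<lambda>m. theta_term (x ^ 3) (x ^ 5) (int m) + theta_term (x ^ 2) (x ^ 5) (int (Suc m)))
      sums (qpoch (x ^ 3) (x ^ 5) * qpoch (x ^ 2) (x ^ 5) * euler_prod (x ^ 5))"
    unfolding quot .
  have "of_real (rr_W q 0 m) = theta_term (x ^ 3) (x ^ 5) (int m) + theta_term (x ^ 2) (x ^ 5) (int (Suc m))" for m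
  proof -
    have t: "Suc m * (Suc m - 1) div 2 = m + m * (m - 1) div 2"
      by (cases m) (auto simp: algebra_simps)
    define y T where "y = x ^ m" and "T = (-1) ^ m * (x ^ 5) ^ (m * (m - 1) div 2)"
    have y5: "(x ^ 5) ^ m = y ^ 5" by (simp add: y_def mult.commute flip: power_mult)
    have "of_real (rr_W q 0 m) = T * y ^ 2 * y * (1 - x ^ 2 * y ^ 4)"
      by (simp add: rr_W_def rr_base_def rr_pf_def T_def y_def x_def mult.commute[of _ 2] flip: power_mult)
    moreover have "theta_term (x ^ 3) (x ^ 5) (int m) = T * y ^ 3"
      unfolding theta_term_power T_def y_def by (simp add: mult_ac)
    moreover have "theta_term (x ^ 2) (x ^ 5) (int (Suc m)) = - T * y ^ 5 * (x * y) ^ 2"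
      unfolding theta_term_power t power_add y5 by (simp add: T_def y_def mult_ac)
    ultimately show ?thesis by (simp add: algebra_simps eval_nat_numeral)
  qed
  hence "(\<lambda>m. complex_of_real (rr_W q 0 m)) sums (qpoch (x ^ 3) (x ^ 5) * qpoch (x ^ 2) (x ^ 5) * euler_prod (x ^ 5))"
    using sums by simp
  moreover have "(\<lambda>m. complex_of_real (rr_W q 0 m)) sums of_real (rr_w q 0)"
    unfolding rr_w_def using summable_sums[OF summable_rr_W] by (simp only: sums_of_real)
  ultimately show ?thesis using sums_unique2 by (simp add: rr_den_def x_def mult_ac)
qed

text \<open>\<open>rr_W\<close> at \<open>j = 1\<close> is not a plain theta series, but
  \<open>suminf_rr_V\<close> replaces its sum by that of \<open>rr_V\<close> at
  \<open>j = 0\<close>, which is one, at \<open>z = x^4\<close>.\<close>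

lemma of_real_rr_w_1: "of_real (rr_w q 1) = rr_num (of_real q) * euler_prod (of_real q ^ 5)"
proof -
  define x where "x = complex_of_real q"
  have x: "norm x < 1" "x \<noteq> 0" using q by (auto simp: x_def)
  have x5: "norm (x ^ 5) < 1" "x ^ 5 \<noteq> 0" using x by (auto simp: norm_power_less_1)
  have quot: "x ^ 5 / x ^ 4 = x ^ 1" using x by (simp add: power_diff[symmetric])
  have "x ^ 4 \<noteq> 0" using x by simp
  from theta_sums[OF x5 this]
  have sums: "(\<lambda>m. theta_term (x ^ 4) (x ^ 5) (int m) + theta_term (x ^ 1) (x ^ 5) (int (Suc m)))
      sums (qpoch (x ^ 4) (x ^ 5) * qpoch (x ^ 1) (x ^ 5) * euler_prod (x ^ 5))"
    unfolding quot .
  have "of_real (rr_V q 0 m) = theta_term (x ^ 4) (x ^ 5) (int m) + theta_term (x ^ 1) (x ^ 5) (int (Suc m))" for m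
  proof -
    have t: "Suc m * (Suc m - 1) div 2 = m + m * (m - 1) div 2"
      by (cases m) (auto simp: algebra_simps)
    define y T where "y = x ^ m" and "T = (-1) ^ m * (x ^ 5) ^ (m * (m - 1) div 2)"
    have y5: "(x ^ 5) ^ m = y ^ 5" by (simp add: y_def mult.commute flip: power_mult)
    have "of_real (rr_V q 0 m) = T * y ^ 2 * y ^ 2 * (1 - x * y ^ 2)"
      by (simp add: rr_V_def rr_base_def rr_pf_def T_def y_def x_def mult.commute[of _ 2] flip: power_mult)
    moreover have "theta_term (x ^ 4) (x ^ 5) (int m) = T * y ^ 4"
      unfolding theta_term_power T_def y_def by (simp add: mult_ac)
    moreover have "theta_term (x ^ 1) (x ^ 5) (int (Suc m)) = - T * y ^ 5 * (x * y)"
      unfolding theta_term_power t power_add y5 by (simp add: T_def y_def mult_ac)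
    ultimately show ?thesis by (simp add: algebra_simps eval_nat_numeral)
  qed
  hence "(\<lambda>m. complex_of_real (rr_V q 0 m)) sums (qpoch (x ^ 4) (x ^ 5) * qpoch (x ^ 1) (x ^ 5) * euler_prod (x ^ 5))"
    using sums by simp
  moreover have "(\<lambda>m. complex_of_real (rr_V q 0 m)) sums of_real (rr_w q (Suc 0))"
    unfolding suminf_rr_V[symmetric] using summable_sums[OF summable_rr_V] by (simp only: sums_of_real)
  ultimately show ?thesis using sums_unique2 by (simp add: rr_num_def x_def mult_ac)
qed

theorem rogers_ramanujan_cf_pos: "rogers_ramanujan_cf q > 0"
  unfolding rogers_ramanujan_cf_eq_quot
  using q by (intro mult_pos_pos divide_pos_pos rr_w_pos real_root_gt_zero) auto

theorem rogers_ramanujan_cf_power5: "of_real (rogers_ramanujan_cf q ^ 5) = rr_z (of_real q)"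
proof -
  have nq: "norm (complex_of_real q ^ 5) < 1" using q by (intro norm_power_less_1) auto
  have "complex_of_real (rr_w q 1 / rr_w q 0) = rr_quot (of_real q)"
    unfolding of_real_divide of_real_rr_w_0 of_real_rr_w_1 rr_quot_def
    using euler_prod_nonzero[OF nq] by simp
  moreover have "rogers_ramanujan_cf q ^ 5 = q * (rr_w q 1 / rr_w q 0) ^ 5"
    unfolding rogers_ramanujan_cf_eq_quot power_mult_distrib using q by (simp add: real_root_pow_pos)
  ultimately show ?thesis by (simp only: rr_z_def of_real_mult of_real_power)
qed

end

section \<open>The hypergeometric series\<close>

text \<open>Applied with \<open>a = 1\<close> to \<open>(-n)_k\<close> and with
  \<open>a = 1/6\<close> to \<open>(5/6 - n)_k\<close>; the signs cancel in the hypergeometric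
  quotient.\<close>

lemma pochhammer_ratio_minus:
  fixes a :: real
  assumes "k \<le> n"
  shows "pochhammer (1 - a - real n) k * pochhammer a (n - k) = (-1) ^ k * pochhammer a n"
proof -
  have "pochhammer (1 - a - real n) k = pochhammer (- (a + real n - 1)) k"
    by (simp add: algebra_simps)
  also have "\<dots> = (-1) ^ k * pochhammer (a + real (n - k)) k"
    unfolding pochhammer_minus using assms by (simp add: of_nat_diff algebra_simps)
  finally show ?thesis
    using pochhammer_product'[of a "n - k" k] assms by (simp add: mult_ac)
qed

lemma pochhammer_one_sixth: "pochhammer (1/6) n * (1 + 6 * real n) = pochhammer (7/6) n"
  using pochhammer_rec[of "1/6 :: real" n] pochhammer_Suc[of "1/6 :: real" n] by (simp add: field_simps)

text \<open>Taylor coefficients of \<open>(1 - y) powr (-1/6)\<close>.\<close>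

definition bin_coeff :: "nat \<Rightarrow> real" where
  "bin_coeff k = pochhammer (1/6) k / fact k"

definition prod_coeff :: "real \<Rightarrow> real \<Rightarrow> nat \<Rightarrow> real" where
  "prod_coeff \<alpha> \<beta> n = (\<Sum>k\<le>n. (bin_coeff k * \<beta> ^ k) * (bin_coeff (n - k) * \<alpha> ^ (n - k)))"

text \<open>Reversing the Pochhammer symbols splits the \<open>k\<close>-th hypergeometric term into
  binomial coefficients at \<open>k\<close> and \<open>n - k\<close>, so the terminating series is a
  Cauchy product; the remaining quotient \<open>(1/6)_n / (7/6)_n\<close> is
  \<open>1 / (1 + 6 n)\<close>.\<close>

lemma hyp2F1_prod_coeff:
  assumes "\<alpha> \<noteq> 0"
  shows "(pochhammer (1/6) n)\<^sup>2 / (pochhammer (7/6) n * fact n) * \<alpha> ^ n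
      * hyp2F1 (1/6) (- real n) (5/6 - real n) (\<beta> / \<alpha>) = prod_coeff \<alpha> \<beta> n / (1 + 6 * real n)"
proof -
  have pos: "pochhammer (1/6 :: real) m > 0" for m by (rule pochhammer_pos) simp
  have term_eq: "pochhammer (1/6) n / fact n * \<alpha> ^ n *
      (pochhammer (1/6) k * pochhammer (- real n) k / pochhammer (5/6 - real n) k * ((\<beta> / \<alpha>) ^ k / fact k))
      = (bin_coeff k * \<beta> ^ k) * (bin_coeff (n - k) * \<alpha> ^ (n - k))" if k: "k \<le> n" for k
  proof -
    have 1: "pochhammer (- real n) k = (-1) ^ k * fact n / fact (n - k)"
      using pochhammer_ratio_minus[OF k, of 1] by (simp add: pochhammer_fact[symmetric] field_simps)
    have 2: "pochhammer (5/6 - real n) k = (-1) ^ k * pochhammer (1/6) n / pochhammer (1/6) (n - k)"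
      using pochhammer_ratio_minus[OF k, of "1/6"] pos[of "n - k"] by (simp add: field_simps)
    have 3: "\<alpha> ^ n = \<alpha> ^ (n - k) * \<alpha> ^ k" using k by (simp flip: power_add)
    show ?thesis
      unfolding 1 2 3 bin_coeff_def using pos[of n] pos[of "n - k"] assms
      by (simp add: power_divide mult_ac)
  qed
  \<comment> \<open>The terms with \<open>k > n\<close> vanish through
    \<open>(-n)_k = 0\<close>.\<close>
  have "hyp2F1 (1/6) (- real n) (5/6 - real n) (\<beta> / \<alpha>) = (\<Sum>k\<le>n.
      pochhammer (1/6) k * pochhammer (- real n) k / pochhammer (5/6 - real n) k * ((\<beta> / \<alpha>) ^ k / fact k))"
    unfolding hyp2F1_def by (rule suminf_finite) (auto simp: pochhammer_of_nat_eq_0_iff)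
  hence A: "pochhammer (1/6) n / fact n * \<alpha> ^ n * hyp2F1 (1/6) (- real n) (5/6 - real n) (\<beta> / \<alpha>)
      = prod_coeff \<alpha> \<beta> n"
    unfolding prod_coeff_def by (simp only: sum_distrib_left) (intro sum.cong refl term_eq, simp)
  have B: "(pochhammer (1/6) n)\<^sup>2 / (pochhammer (7/6) n * fact n)
      = pochhammer (1/6) n / fact n * (1 / (1 + 6 * real n))"
  proof -
    have "1 + 6 * real n > 0" by (simp add: add_pos_nonneg)
    thus ?thesis unfolding pochhammer_one_sixth[symmetric] using pos[of n]
      by (simp add: power2_eq_square)
  qed
  have "pochhammer (1/6) n / fact n * (1 / (1 + 6 * real n)) * \<alpha> ^ n
      * hyp2F1 (1/6) (- real n) (5/6 - real n) (\<beta> / \<alpha>)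
      = pochhammer (1/6) n / fact n * \<alpha> ^ n
      * hyp2F1 (1/6) (- real n) (5/6 - real n) (\<beta> / \<alpha>) * (1 / (1 + 6 * real n))"
    by (simp only: mult_ac)
  thus ?thesis unfolding A B by simp
qed

lemma bin_coeff_sums:
  assumes "\<bar>y\<bar> < 1"
  shows "(\<lambda>n. bin_coeff n * y ^ n) sums (1 - y) powr (-1/6)"
proof -
  have "(\<lambda>n. ((-1/6) gchoose n) * (- y) ^ n) sums (1 + (- y)) powr (-1/6)"
    by (rule gen_binomial_real) (use assms in simp)
  moreover have "((-1/6) gchoose n) * (- y) ^ n = bin_coeff n * y ^ n" for n
  proof -
    have "(- y) ^ n = (-1) ^ n * y ^ n" by (rule power_minus)
    moreover have "(-1) ^ n * (-1) ^ n = (1 :: real)" by (simp flip: power_mult_distrib)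
    ultimately show ?thesis by (simp add: gbinomial_pochhammer bin_coeff_def)
  qed
  ultimately show ?thesis by simp
qed

lemma summable_norm_bin_coeff:
  assumes "\<bar>y\<bar> < 1"
  shows "summable (\<lambda>n. norm (bin_coeff n * y ^ n))"
proof -
  have "bin_coeff n \<ge> 0" for n
    by (simp add: bin_coeff_def pochhammer_nonneg)
  hence "norm (bin_coeff n * y ^ n) = bin_coeff n * \<bar>y\<bar> ^ n" for n
    by (simp add: abs_mult power_abs)
  thus ?thesis using bin_coeff_sums[of "\<bar>y\<bar>"] assms by (simp add: sums_iff)
qed

lemma prod_coeff_sums:
  assumes "\<bar>\<alpha> * x\<bar> < 1" "\<bar>\<beta> * x\<bar> < 1"
  shows "(\<lambda>n. prod_coeff \<alpha> \<beta> n * x ^ n) sums ((1 - \<alpha> * x) * (1 - \<beta> * x)) powr (-1/6)"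
proof -
  have "prod_coeff \<alpha> \<beta> n * x ^ n = (\<Sum>k\<le>n. (bin_coeff k * (\<beta> * x) ^ k) * (bin_coeff (n - k) * (\<alpha> * x) ^ (n - k)))" for n
    unfolding prod_coeff_def sum_distrib_right
  proof (rule sum.cong[OF refl])
    fix k assume "k \<in> {..n}"
    hence "x ^ n = x ^ k * x ^ (n - k)" by (simp flip: power_add)
    thus "bin_coeff k * \<beta> ^ k * (bin_coeff (n - k) * \<alpha> ^ (n - k)) * x ^ n =
        bin_coeff k * (\<beta> * x) ^ k * (bin_coeff (n - k) * (\<alpha> * x) ^ (n - k))"
      by (simp add: power_mult_distrib)
  qed
  moreover have "(\<lambda>n. \<Sum>k\<le>n. (bin_coeff k * (\<beta> * x) ^ k) * (bin_coeff (n - k) * (\<alpha> * x) ^ (n - k)))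
      sums ((1 - \<beta> * x) powr (-1/6) * (1 - \<alpha> * x) powr (-1/6))"
    using Cauchy_product_sums[OF summable_norm_bin_coeff[OF assms(2)] summable_norm_bin_coeff[OF assms(1)]]
      bin_coeff_sums[OF assms(1)] bin_coeff_sums[OF assms(2)]
    by (simp add: sums_iff)
  moreover have "(1 - \<beta> * x) powr (-1/6) * (1 - \<alpha> * x) powr (-1/6) = ((1 - \<alpha> * x) * (1 - \<beta> * x)) powr (-1/6)"
    using assms by (simp add: powr_mult abs_less_iff mult.commute)
  ultimately show ?thesis by simp
qed

text \<open>If \<open>S x = (\<Sum>n. c n / (1 + 6 n) x\<^sup>n)\<close> then \<open>S x + 6 x S' x = (\<Sum>n. c n x\<^sup>n)\<close>.\<close>

lemma powr_series_derivative:
  fixes c :: "nat \<Rightarrow> real"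
  assumes summ: "\<And>y. \<bar>y\<bar> < K \<Longrightarrow> summable (\<lambda>n. c n * y ^ n)" and x: "0 < x" "x < K"
  shows "summable (\<lambda>n. c n / (1 + 6 * real n) * x ^ n)"
    and "((\<lambda>y. y powr (1/6) * (\<Sum>n. c n / (1 + 6 * real n) * y ^ n)) has_real_derivative
          1/6 * x powr (-5/6) * (\<Sum>n. c n * x ^ n)) (at x)"
proof -
  define d where "d = (\<lambda>n. c n / (1 + 6 * real n))"
  have sd: "summable (\<lambda>n. norm (d n * z ^ n))" if z: "\<bar>z\<bar> < K" for z
  proof (rule summable_comparison_test)
    obtain z' where z': "\<bar>z\<bar> < z'" "z' < K" using dense[OF z] by blast
    show "summable (\<lambda>n. norm (c n * z ^ n))"
      by (rule powser_insidea[of c z']) (use z' summ[of z'] in auto)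
    have "norm (norm (d n * z ^ n)) \<le> norm (c n * z ^ n)" for n
    proof -
      have "\<bar>1 + 6 * real n\<bar> = 1 + 6 * real n" by simp
      hence "\<bar>d n\<bar> \<le> \<bar>c n\<bar>"
        using mult_left_mono[of 1 "1 + 6 * real n" "\<bar>c n\<bar>"]
        by (simp add: d_def abs_divide divide_le_eq)
      thus ?thesis by (simp add: abs_mult mult_right_mono)
    qed
    thus "\<exists>N. \<forall>n\<ge>N. norm (norm (d n * z ^ n)) \<le> norm (c n * z ^ n)" by blast
  qed
  have s1: "summable (\<lambda>n. d n * z ^ n)" if "\<bar>z\<bar> < K" for z
    using summable_norm_cancel[OF sd[OF that]] .
  show "summable (\<lambda>n. c n / (1 + 6 * real n) * x ^ n)"
    using s1[of x] x by (simp add: d_def)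
  define S S' where "S = (\<Sum>n. d n * x ^ n)" and "S' = (\<Sum>n. diffs d n * x ^ n)"
  have D: "((\<lambda>y. \<Sum>n. d n * y ^ n) has_real_derivative S') (at x)"
    unfolding S'_def by (rule termdiffs_strong'[of K d]) (use s1 x in auto)
  have "summable (\<lambda>n. diffs d n * x ^ n)"
    by (rule termdiff_converges[of x K]) (use x s1 in auto)
  from sums_mult2[OF diffs_equiv[OF this], of "6 * x"]
  have "(\<lambda>n. real n * d n * x ^ (n - Suc 0) * (6 * x)) sums (S' * (6 * x))"
    unfolding S'_def .
  \<comment> \<open>At \<open>n = 0\<close> the truncated exponent is 0 instead of -1, which the
    factor \<open>real n\<close> makes harmless.\<close>
  moreover have "real n * d n * x ^ (n - Suc 0) * (6 * x) = 6 * real n * d n * x ^ n" for n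
    by (cases n) auto
  ultimately have "(\<lambda>n. 6 * real n * d n * x ^ n) sums (S' * (6 * x))" by simp
  moreover have "(\<lambda>n. d n * x ^ n) sums S" unfolding S_def using s1[of x] x by (simp add: summable_sums)
  ultimately have "(\<lambda>n. d n * x ^ n + 6 * real n * d n * x ^ n) sums (S + S' * (6 * x))"
    by (intro sums_add)
  moreover have "d n * x ^ n + 6 * real n * d n * x ^ n = c n * x ^ n" for n
  proof -
    have "1 + 6 * real n > 0" by (simp add: add_pos_nonneg)
    hence "d n * (1 + 6 * real n) = c n" by (simp add: d_def)
    thus ?thesis by (metis distrib_left distrib_right mult.commute mult.right_neutral)
  qed
  ultimately have key: "(\<Sum>n. c n * x ^ n) = S + S' * (6 * x)" by (simp add: sums_iff)
  have "((\<lambda>y. y powr (1/6)) has_real_derivative 1/6 * x powr (1/6 - 1)) (at x)"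
    using x by (intro has_real_derivative_powr) auto
  from DERIV_mult[OF this D]
  have d1: "((\<lambda>y. y powr (1/6) * (\<Sum>n. d n * y ^ n)) has_real_derivative
      1/6 * x powr (1/6 - 1) * S + S' * x powr (1/6)) (at x)"
    by (simp add: S_def)
  have "x powr (1/6) = x powr (-5/6) * x"
    using x powr_add[of x "-5/6" 1] by simp
  hence eq: "1/6 * x powr (1/6 - 1) * S + S' * x powr (1/6) = 1/6 * x powr (-5/6) * (\<Sum>n. c n * x ^ n)"
    unfolding key by (simp add: algebra_simps)
  show "((\<lambda>y. y powr (1/6) * (\<Sum>n. c n / (1 + 6 * real n) * y ^ n)) has_real_derivative
          1/6 * x powr (-5/6) * (\<Sum>n. c n * x ^ n)) (at x)"
    using d1 unfolding eq unfolding d_def .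
qed

section \<open>Restriction to the imaginary axis and the derivative of Phi\<close>

lemma power_powr:
  fixes x :: real
  assumes "x > 0"
  shows "(x ^ n) powr a = x powr (real n * a)"
  unfolding powr_realpow[OF assms, symmetric] by (rule powr_powr)

lemma dedekind_eta_imaginary:
  assumes "t > 0"
  shows "dedekind_eta (\<i> * of_real t) = of_real (exp (- pi * t / 12)) * euler_prod (of_real (exp (- 2 * pi * t)))"
proof -
  have "exp (2 * complex_of_real pi * \<i> * of_nat (Suc n) * (\<i> * of_real t))
      = of_real (exp (- 2 * pi * t)) * of_real (exp (- 2 * pi * t)) ^ n" for n
  proof -
    have "2 * complex_of_real pi * \<i> * of_nat (Suc n) * (\<i> * of_real t) = of_nat (Suc n) * of_real (- 2 * pi * t)"
      by (simp add: algebra_simps)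
    also have "exp \<dots> = exp (of_real (- 2 * pi * t)) ^ Suc n" by (rule exp_of_nat_mult)
    finally show ?thesis by (simp only: exp_of_real power_Suc)
  qed
  moreover have "of_real pi * \<i> * (\<i> * of_real t) / 12 = complex_of_real (- pi * t / 12)"
    by (simp add: algebra_simps)
  ultimately show ?thesis
    by (simp only: dedekind_eta_def euler_prod_def qpoch_def exp_of_real)
qed

definition rr_fifth :: "real \<Rightarrow> real" where
  "rr_fifth t = rogers_ramanujan_cf (exp (- 2 * pi * t)) ^ 5"

text \<open>\<open>q = exp (- 2 pi t)\<close> turns \<open>q d/dq\<close> into
  \<open>- 1 / (2 pi) d/dt\<close>, so this is \<open>rr_E_eq\<close> read on the half line. The
  derivative is computed for the holomorphic \<open>rr_z\<close> and then transferred by real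
  parts.\<close>

lemma rr_fifth_has_derivative:
  assumes t: "t > 0"
  defines "q \<equiv> exp (- 2 * pi * t)"
  shows "(rr_fifth has_real_derivative
     - 2 * pi * rr_fifth t * Re (euler_prod (of_real q)) ^ 5 / Re (euler_prod (of_real (q ^ 5)))) (at t)"
proof -
  have q: "0 < q" "q < 1" using t by (simp_all add: q_def)
  have q5: "0 < q ^ 5" "q ^ 5 < 1" using q by (auto simp: power_less_one_iff)
  have nq: "norm (complex_of_real q) < 1" "complex_of_real q \<noteq> 0" using q by auto
  define x where "x = complex_of_real q"
  define e p where "e = Re (euler_prod (of_real q))" and "p = Re (euler_prod (of_real (q ^ 5)))"
  have e: "euler_prod x = of_real e" unfolding x_def e_def by (rule euler_prod_of_real[OF q])
  have p: "euler_prod (x ^ 5) = of_real p"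
    unfolding x_def p_def of_real_power[symmetric] by (rule euler_prod_of_real[OF q5])
  have "p > 0" unfolding p_def by (rule Re_euler_prod_pos[OF q5])
  have z: "rr_z x = of_real (rr_fifth t)"
    unfolding rr_fifth_def x_def q_def[symmetric] by (rule rogers_ramanujan_cf_power5[OF q, symmetric])
  have E: "rr_E x = of_real (e ^ 5 / p)"
    using rr_E_eq[OF nq] \<open>p > 0\<close> unfolding x_def[symmetric] e p by (simp add: field_simps)
  have "((\<lambda>t. complex_of_real (exp (- 2 * pi * t))) has_vector_derivative of_real (- 2 * pi * q)) (at t)"
    unfolding q_def
    by (rule has_vector_derivative_of_real) (auto intro!: derivative_eq_intros)
  from field_vector_diff_chain_at[OF this, of rr_z] rr_z_has_field_derivative[OF nq(1)]
  have "((\<lambda>t. rr_z (of_real (exp (- 2 * pi * t)))) has_vector_derivative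
      of_real (- 2 * pi * q) * (rr_quot x ^ 5 * rr_E x)) (at t)"
    by (simp add: o_def x_def q_def)
  also have "of_real (- 2 * pi * q) * (rr_quot x ^ 5 * rr_E x) = of_real (- 2 * pi) * rr_z x * rr_E x"
    by (simp add: rr_z_def x_def)
  also have "\<dots> = of_real (- 2 * pi * rr_fifth t * e ^ 5 / p)"
    unfolding z E by simp
  finally have "((\<lambda>t. rr_z (of_real (exp (- 2 * pi * t)))) has_vector_derivative
      of_real (- 2 * pi * rr_fifth t * e ^ 5 / p)) (at t)" .
  from has_field_derivative_Re[OF this]
  have "((\<lambda>t. Re (rr_z (of_real (exp (- 2 * pi * t))))) has_real_derivative
      - 2 * pi * rr_fifth t * e ^ 5 / p) (at t)" by simp
  thus ?thesis unfolding e_def p_def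
  proof (rule has_field_derivative_transform_within_open[where S = "{0<..}"])
    fix u :: real assume "u \<in> {0<..}"
    hence "exp (- 2 * pi * u) < 1" by simp
    from rogers_ramanujan_cf_power5[OF _ this, symmetric]
    show "Re (rr_z (of_real (exp (- 2 * pi * u)))) = rr_fifth u" by (simp add: rr_fifth_def)
  qed (use t in auto)
qed

lemma rr_fifth_quotient:
  assumes t: "t > 0"
  defines "q \<equiv> exp (- 2 * pi * t)"
  shows "rr_fifth t / (1 - 11 * rr_fifth t - rr_fifth t ^ 2)
    = q * Re (euler_prod (of_real (q ^ 5))) ^ 6 / Re (euler_prod (of_real q)) ^ 6"
proof -
  have q: "0 < q" "q < 1" using t by (simp_all add: q_def)
  have q5: "0 < q ^ 5" "q ^ 5 < 1" using q by (auto simp: power_less_one_iff)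
  have nq: "norm (complex_of_real q) < 1" "complex_of_real q \<noteq> 0" using q by auto
  have z: "rr_z (of_real q) = of_real (rr_fifth t)"
    unfolding rr_fifth_def q_def[symmetric] by (rule rogers_ramanujan_cf_power5[OF q, symmetric])
  have "complex_of_real (rr_fifth t / (1 - 11 * rr_fifth t - rr_fifth t ^ 2))
    = of_real (q * Re (euler_prod (of_real (q ^ 5))) ^ 6 / Re (euler_prod (of_real q)) ^ 6)"
    using rr_z_quotient[OF nq] unfolding z
    by (subst (asm) euler_prod_of_real[OF q], subst (asm) of_real_power[symmetric], subst (asm) euler_prod_of_real[OF q5]) simp
  thus ?thesis by (simp only: of_real_eq_iff)
qed

lemma rr_fifth_pos: "t > 0 \<Longrightarrow> rr_fifth t > 0"
  unfolding rr_fifth_def by (intro zero_less_power rogers_ramanujan_cf_pos) auto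

theorem theorem1:
  fixes \<tau> :: real
  assumes "\<tau> > 0"
  shows "summable (Phi_term \<tau>) \<and>
    ((\<lambda>t. complex_of_real (Phi t)) has_vector_derivative
       - (of_real pi / 3) * dedekind_eta (\<i> * of_real \<tau>) ^ 4) (at \<tau>)"
proof -
  \<comment> \<open>Reciprocals of the two zeros of \<open>1 - 11 x - x^2\<close>; the smaller
    modulus of \<open>\<beta>\<close> makes \<open>1 / \<alpha>\<close> the bound for
    convergence.\<close>
  define \<alpha> \<beta> :: real where "\<alpha> = (11 + 5 * sqrt 5) / 2" and "\<beta> = (11 - 5 * sqrt 5) / 2"
  have "sqrt 5 > (11/5 :: real)" by (rule real_less_rsqrt) (simp add: power2_eq_square)
  hence ab: "\<alpha> > 0" "\<beta> < 0" "\<bar>\<beta>\<bar> \<le> \<alpha>" by (auto simp: \<alpha>_def \<beta>_def)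
  have ratio: "(11 - 5 * sqrt 5) / (11 + 5 * sqrt 5) = \<beta> / \<alpha>"
  proof -
    have "x / y = (x / 2) / (y / 2)" for x y :: real by simp
    thus ?thesis unfolding \<alpha>_def \<beta>_def .
  qed
  have factor: "1 - 11 * x - x ^ 2 = (1 - \<alpha> * x) * (1 - \<beta> * x)" for x
  proof -
    have "\<alpha> + \<beta> = 11" by (simp add: \<alpha>_def \<beta>_def field_simps)
    moreover have "\<alpha> * \<beta> = - 1" by (simp add: \<alpha>_def \<beta>_def algebra_simps)
    moreover have "(1 - \<alpha> * x) * (1 - \<beta> * x) = 1 - (\<alpha> + \<beta>) * x + \<alpha> * \<beta> * x ^ 2"
      by (simp add: algebra_simps power2_eq_square)
    ultimately show ?thesis by simp
  qed
  define c where "c = prod_coeff \<alpha> \<beta>"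
  have c_sums: "(\<lambda>n. c n * x ^ n) sums (1 - 11 * x - x ^ 2) powr (-1/6)" if "\<bar>x\<bar> < 1 / \<alpha>" for x
  proof -
    have "\<bar>\<alpha> * x\<bar> < 1" using that ab by (simp add: abs_mult field_simps)
    moreover have "\<bar>\<beta> * x\<bar> \<le> \<bar>\<alpha> * x\<bar>"
      unfolding abs_mult using ab by (intro mult_right_mono) auto
    ultimately show ?thesis unfolding c_def factor by (intro prod_coeff_sums) auto
  qed
  have term_eq: "Phi_term t n = c n / (1 + 6 * real n) * rr_fifth t ^ n" for t n
    unfolding Phi_term_def ratio \<alpha>_def[symmetric] rr_fifth_def c_def
    using hyp2F1_prod_coeff[of \<alpha> n \<beta>] ab by (simp add: power_mult)
  define F where "F = (\<lambda>x. x powr (1/6) * (\<Sum>n. c n / (1 + 6 * real n) * x ^ n))"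
  have Phi_eq: "Phi t = F (rr_fifth t)" if "t > 0" for t
  proof -
    have "rogers_ramanujan_cf (exp (- 2 * pi * t)) > 0"
      by (rule rogers_ramanujan_cf_pos) (use that in auto)
    hence "rogers_ramanujan_cf (exp (- 2 * pi * t)) powr (5/6) = rr_fifth t powr (1/6)"
      by (simp add: rr_fifth_def power_powr)
    thus ?thesis by (simp add: Phi_def F_def term_eq)
  qed
  define q z e p Q where "q = exp (- 2 * pi * \<tau>)" and "z = rr_fifth \<tau>"
    and "e = Re (euler_prod (of_real q))" and "p = Re (euler_prod (of_real (q ^ 5)))" and "Q = 1 - 11 * z - z ^ 2"
  have q: "0 < q" "q < 1" using assms by (simp_all add: q_def)
  have q5: "0 < q ^ 5" "q ^ 5 < 1" using q by (auto simp: power_less_one_iff)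
  have e: "e > 0" unfolding e_def by (rule Re_euler_prod_pos[OF q])
  have p: "p > 0" unfolding p_def by (rule Re_euler_prod_pos[OF q5])
  have z: "z > 0" unfolding z_def by (rule rr_fifth_pos[OF assms])
  have quot: "z / Q = q * p ^ 6 / e ^ 6"
    using rr_fifth_quotient[OF assms] by (simp add: Q_def z_def q_def e_def p_def)
  \<comment> \<open>The product formula puts \<open>z\<close> inside the disc of convergence without
    any numerical estimate: it forces \<open>Q > 0\<close>, and as \<open>1 - \<beta> z > 0\<close>,
    also \<open>1 - \<alpha> z > 0\<close>.\<close>
  have "z / Q > 0" unfolding quot using q p e by simp
  hence Q: "Q > 0" using z by (simp add: zero_less_divide_iff)
  have "1 - \<beta> * z > 0" using ab z mult_neg_pos[of \<beta> z] by simp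
  with Q have "1 - \<alpha> * z > 0" unfolding Q_def factor by (simp add: zero_less_mult_iff)
  hence z_lt: "z < 1 / \<alpha>" using ab by (simp add: field_simps)
  note deriv = powr_series_derivative[of "1 / \<alpha>" c z, OF sums_summable[OF c_sums] z z_lt]
  have "(\<Sum>n. c n * z ^ n) = Q powr (-1/6)"
    using c_sums[of z] z z_lt by (simp add: sums_iff Q_def)
  with deriv(2) have "(F has_real_derivative 1/6 * z powr (-5/6) * Q powr (-1/6)) (at (rr_fifth \<tau>))"
    by (simp add: F_def z_def)
  from DERIV_chain2[OF this rr_fifth_has_derivative[OF assms, folded q_def]]
  have "((\<lambda>t. F (rr_fifth t)) has_real_derivative
      1/6 * z powr (-5/6) * Q powr (-1/6) * (- 2 * pi * z * e ^ 5 / p)) (at \<tau>)"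
    by (simp only: z_def e_def p_def)
  hence D: "(Phi has_real_derivative
      1/6 * z powr (-5/6) * Q powr (-1/6) * (- 2 * pi * z * e ^ 5 / p)) (at \<tau>)"
    by (rule has_field_derivative_transform_within_open[where S = "{0<..}"])
       (use assms Phi_eq in auto)
  \<comment> \<open>Solved for \<open>Q\<close>, the identity has an explicit root of order -1/6:
    the sixth powers give \<open>p / e\<close>, and \<open>q^(1/6)\<close> becomes
    \<open>exp (- pi \<tau> / 3)\<close>.\<close>
  have "Q = z * (e / p) ^ 6 * inverse q"
    using quot q p e z Q by (simp add: field_simps)
  hence "Q powr (-1/6) = z powr (-1/6) * ((e / p) ^ 6) powr (-1/6) * inverse q powr (-1/6)"
    using q p e z by (simp add: powr_mult)
  also have "((e / p) ^ 6) powr (-1/6) = p / e"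
  proof -
    have "((e / p) ^ 6) powr (-1/6) = (e / p) powr (6 * (-1/6))"
      using e p by (subst power_powr) auto
    thus ?thesis using e p by (simp add: powr_minus)
  qed
  also have "inverse q powr (-1/6) = exp (- pi * \<tau> / 3)"
    by (simp add: q_def powr_def exp_minus[symmetric])
  finally have "z powr (-5/6) * Q powr (-1/6) * z
      = (z powr (-5/6) * z powr (-1/6) * z) * (p / e * exp (- pi * \<tau> / 3))"
    by (simp add: mult_ac)
  also have "z powr (-5/6) * z powr (-1/6) * z = 1"
  proof -
    have "z powr (-5/6) * z powr (-1/6) = z powr (-5/6 + -1/6)" by (rule powr_add[symmetric])
    also have "\<dots> = 1 / z" using z by (simp add: powr_neg_one)
    finally show ?thesis using z by simp
  qed
  finally have zQ: "z powr (-5/6) * Q powr (-1/6) * z = p / e * exp (- pi * \<tau> / 3)" by simp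
  \<comment> \<open>The powers of \<open>z\<close> have cancelled, and \<open>p / e\<close> from the
    quadratic meets \<open>e^5 / p\<close> from the derivative of \<open>z\<close>; what remains is
    \<open>e^4\<close>, matching the fourth power of eta.\<close>
  note D
  also have "1/6 * z powr (-5/6) * Q powr (-1/6) * (- 2 * pi * z * e ^ 5 / p)
      = - (pi / 3) * (z powr (-5/6) * Q powr (-1/6) * z) * (e ^ 5 / p)"
    by simp
  also have "\<dots> = - (pi / 3) * (exp (- pi * \<tau> / 3) * e ^ 4)"
    unfolding zQ using e p by (simp add: eval_nat_numeral)
  finally have "(Phi has_real_derivative - (pi / 3) * (exp (- pi * \<tau> / 3) * e ^ 4)) (at \<tau>)" .
  hence "((\<lambda>t. complex_of_real (Phi t)) has_vector_derivative
      of_real (- (pi / 3) * (exp (- pi * \<tau> / 3) * e ^ 4))) (at \<tau>)"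
    by (rule has_vector_derivative_of_real)
  moreover have "dedekind_eta (\<i> * of_real \<tau>) = of_real (exp (- pi * \<tau> / 12) * e)"
    using dedekind_eta_imaginary[OF assms] euler_prod_of_real[OF q] by (simp add: q_def e_def)
  hence "dedekind_eta (\<i> * of_real \<tau>) ^ 4 = of_real (exp (- pi * \<tau> / 3) * e ^ 4)"
    by (simp add: power_mult_distrib flip: exp_of_nat_mult of_real_power)
  ultimately have "((\<lambda>t. complex_of_real (Phi t)) has_vector_derivative
       - (of_real pi / 3) * dedekind_eta (\<i> * of_real \<tau>) ^ 4) (at \<tau>)"
    by simp
  moreover have "summable (Phi_term \<tau>)"
    using deriv(1) unfolding z_def term_eq[symmetric] .
  ultimately show ?thesis by blast
qed

end
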